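(* Suppose $S\sim\mathrm{Poisson}(\mu)$. Then for $v\in\{2,\dots,J\}$ and non-negative integers $n_1,\dots,n_v$ with $n_v\ge1$, $$P\big[\mathbf{N}(t)=(n_1,\dots,n_v,0,\dots,0)\big]=\sum_{i_1=0}^{n_1}\cdots\sum_{i_{v-1}=0}^{n_{v-1}}\ \sum_{i_v=1}^{n_v}\Big[\frac{i_v}{n_v}\cdot P\big[\mathbf{N}(t)=(n_1-i_1,\dots,n_v-i_v,0,\dots,0)\big]\cdot\int_0^t\lambda(\tau)\Big[\prod_{k=1}^v\frac{(q_k(t-\tau)\mu)^{i_k}}{i_k!}\Big]e^{-\mu}\,d\tau\Big].$$
   Context: Consider an open network of $J$ infinite server queues, indexed $1,\dots,J$, empty at time $0$. Batches arrive at the points $T_1,T_2,\dots$ of a non-homogeneous Poisson process on $[0,\infty)$ with rate $\lambda(t)$, where $\int_0^t\lambda(\tau)\,d\tau<\infty$ for all $t$. At time $T_i$, $\Sigma_{ij}$ customers arrive at queue $j$, for $j=1,\dots,J$. The vectors $\mathbf{\Sigma}_i=(\Sigma_{i1},\dots,\Sigma_{iJ})$ are independent random vectors with non-negative integer components, all with the same distribution as a generic vector $\mathbf{S}=(S_1,\dots,S_J)$. It is assumed that $\mathbb{E}\big[\prod_{j=1}^J z_j^{S_j}\big]=G_S\big(\sum_{j=1}^J p_jz_j\big)$, where $p_j\ge0$, $\sum_{j=1}^J p_j=1$, and $G_S(z)=\mathbb{E}[z^S]$ is the probability generating function of a univariate non-negative integer-valued random variable $S$. This corresponds to a univariate batch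 of size $S$, with each incoming customer independently assigned entry queue $j$ with probability $p_j$. Here $\mathrm{Poisson}(\mu)$ denotes the Poisson distribution with mean $\mu$. The $\ell$th customer entering queue $j$ at time $T_i$ is marked with a stochastic process $X^j_{i,\ell}(t)$, $t\ge 0$, where $X^j_{i,\ell}(t)=k\in\{1,\dots,J\}$ if the customer is in queue $k$ at time $T_i+t$; customers may leave the network. For each $i$ and $\ell=1,\dots,\Sigma_{ij}$, the processes $X^j_{i,\ell}$ are selected independently with a law such that $P(X^j_{i,\ell}(t)=k)=q^j_k(t)$; the routes of customers through the network are mutually independent, conditional on the node of entry. Put $q_k(t)=\sum_{j=1}^J p_j\,q^j_k(t)$, the probability that a customer is in queue $k$ a time $t$ after arrival into the network. $\mathbf{N}(t)=(N_1(t),\dots,N_J(t))$, where $N_k(t)$ is the number of customers in queue $k$ at time $t\ge 0$. In the vectors $(\cdot,\dots,\cdot,0,\dots,0)$, entries $v+1,\dots,J$ are zero.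
   Formalization: The factor e^{-μ} is wrong if customers may leave the network; the theorem proves the recursion with exp(-μ·Σ_{k=1}^J q_k(t-τ)) in its place, and the formula as printed when Σ_{k=1}^J q_k(s)=1 for all s in [0,t]. *)

theory Defs
  imports "HOL-Probability.Probability"
begin

text \<open>
  The library constant \<^const>\<open>poisson_pmf\<close> is specified for a positive mean only; the
  degenerate case is the unit mass at 0.
\<close>

definition poisson_law :: "real \<Rightarrow> nat pmf" where
  "poisson_law m = (if m = 0 then return_pmf 0 else poisson_pmf m)"

lemma pmf_poisson_law:
  assumes "m \<ge> 0"
  shows "pmf (poisson_law m) k = m ^ k / fact k * exp (- m)"
  using assms by (cases "m = 0") (auto simp: poisson_law_def power_0_left)

definition prob_gen_fun :: "nat pmf \<Rightarrow> real \<Rightarrow> real" where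
  "prob_gen_fun S z = measure_pmf.expectation S (\<lambda>n. z ^ n)"

text \<open>
  Points of a Poisson process are enumerated by \<^term>\<open>T :: nat \<Rightarrow> 'a \<Rightarrow> ereal\<close>. If the process
  has only finitely many points (possible when the total intensity is finite), the remaining
  entries are \<open>\<infinity>\<close>. Local finiteness has to be required separately, because \<^const>\<open>card\<close>
  is 0 on infinite sets.
\<close>

definition point_count :: "(nat \<Rightarrow> 'a \<Rightarrow> ereal) \<Rightarrow> real set \<Rightarrow> 'a \<Rightarrow> nat" where
  "point_count T B \<omega> = card {i. T i \<omega> \<in> ereal ` B}"

definition poisson_process ::
  "'a measure \<Rightarrow> (real \<Rightarrow> real) \<Rightarrow> (nat \<Rightarrow> 'a \<Rightarrow> ereal) \<Rightarrow> bool" where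
  "poisson_process M lam T \<longleftrightarrow>
     (\<forall>i. T i \<in> borel_measurable M) \<and>
     (\<forall>i. \<forall>\<omega>\<in>space M. 0 \<le> T i \<omega> \<and> T i \<omega> \<le> T (Suc i) \<omega>) \<and>
     (\<forall>t::real. AE \<omega> in M. finite {i. T i \<omega> \<le> ereal t}) \<and>
     (\<forall>t. \<forall>B\<in>sets borel. B \<subseteq> {0..t} \<longrightarrow>
        point_count T B \<in> measurable M (count_space UNIV) \<and>
        distr M (count_space UNIV) (point_count T B)
          = measure_pmf (poisson_law (LBINT s:B. lam s))) \<and>
     (\<forall>t (m::nat) (B :: nat \<Rightarrow> real set).
        (\<forall>r<m. B r \<in> sets borel \<and> B r \<subseteq> {0..t}) \<and> disjoint_family_on B {..<m} \<longrightarrow>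
        prob_space.indep_vars M (\<lambda>_. count_space UNIV) (\<lambda>r. point_count T (B r)) {..<m})"

text \<open>
  \<^term>\<open>Sig i j \<omega>\<close> is the number of customers entering queue \<open>j \<in> {1..J}\<close> at time \<^term>\<open>T i \<omega>\<close>;
  they are labelled \<open>l < Sig i j \<omega>\<close>. \<^term>\<open>X i j l \<omega> s\<close> is the position of the
  \<open>l\<close>-th of them at time \<open>s\<close> after arrival; a value outside \<open>{1..J}\<close> means that the
  customer has left the network.
\<close>

definition queue_count ::
  "nat \<Rightarrow> (nat \<Rightarrow> 'a \<Rightarrow> ereal) \<Rightarrow> (nat \<Rightarrow> nat \<Rightarrow> 'a \<Rightarrow> nat) \<Rightarrow>
   (nat \<Rightarrow> nat \<Rightarrow> nat \<Rightarrow> 'a \<Rightarrow> real \<Rightarrow> nat) \<Rightarrow> real \<Rightarrow> nat \<Rightarrow> 'a \<Rightarrow> nat" where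
  "queue_count J T Sig X t k \<omega> =
     card {(i, j, l). j \<in> {1..J} \<and> l < Sig i j \<omega> \<and> T i \<omega> \<le> ereal t \<and>
                      X i j l \<omega> (t - real_of_ereal (T i \<omega>)) = k}"

definition queue_prob :: "nat \<Rightarrow> (nat \<Rightarrow> real) \<Rightarrow> (nat \<Rightarrow> nat \<Rightarrow> real \<Rightarrow> real) \<Rightarrow>
    nat \<Rightarrow> real \<Rightarrow> real" where
  "queue_prob J p qe k s = (\<Sum>j=1..J. p j * qe j k s)"

datatype source = Arrivals | Batch nat | Route nat nat nat

definition source_algebra ::
  "'a measure \<Rightarrow> nat \<Rightarrow> (real \<Rightarrow> nat) measure \<Rightarrow> (nat \<Rightarrow> 'a \<Rightarrow> ereal) \<Rightarrow>
   (nat \<Rightarrow> nat \<Rightarrow> 'a \<Rightarrow> nat) \<Rightarrow> (nat \<Rightarrow> nat \<Rightarrow> nat \<Rightarrow> 'a \<Rightarrow> real \<Rightarrow> nat) \<Rightarrow>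
   source \<Rightarrow> 'a measure" where
  "source_algebra M J D T Sig X u =
     (case u of
        Arrivals \<Rightarrow> vimage_algebra (space M) (\<lambda>\<omega> i. T i \<omega>) (\<Pi>\<^sub>M i\<in>UNIV. borel)
      | Batch i \<Rightarrow> vimage_algebra (space M) (\<lambda>\<omega>. \<lambda>j\<in>{1..J}. Sig i j \<omega>)
                     (\<Pi>\<^sub>M j\<in>{1..J}. count_space UNIV)
      | Route i j l \<Rightarrow> vimage_algebra (space M) (X i j l) D)"

text \<open>
  The routes are random elements of a measurable space \<open>D\<close> of paths on which evaluation is
  jointly measurable (for instance, right-continuous paths with the cylinder \<open>\<sigma>\<close>-algebra).
  Independence of the arrival times and the cylinder events alone would not determine the law of
  a route evaluated at a random time: for \<open>X(s) = indicator {U} s\<close> with \<open>U\<close> uniform, the cylinder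
  events are trivial, hence independent of \<open>U\<close>, yet \<open>X(U) = 1\<close>.

  \<open>BS\<close> is the law of the generic batch vector and \<open>S\<close> the law of the univariate
  batch size. A pgf identity on \<open>[0,1]\<^sup>J\<close> determines \<open>BS\<close>.
\<close>

locale batch_network = prob_space M for M :: "'a measure" +
  fixes J :: nat
    and lam :: "real \<Rightarrow> real"
    and T :: "nat \<Rightarrow> 'a \<Rightarrow> ereal"
    and BS :: "(nat \<Rightarrow> nat) measure"
    and S :: "nat pmf"
    and p :: "nat \<Rightarrow> real"
    and Sig :: "nat \<Rightarrow> nat \<Rightarrow> 'a \<Rightarrow> nat"
    and D :: "(real \<Rightarrow> nat) measure"
    and X :: "nat \<Rightarrow> nat \<Rightarrow> nat \<Rightarrow> 'a \<Rightarrow> real \<Rightarrow> nat"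
    and qe :: "nat \<Rightarrow> nat \<Rightarrow> real \<Rightarrow> real"
  assumes lam_nonneg: "\<And>s. 0 \<le> s \<Longrightarrow> 0 \<le> lam s"
    and lam_integrable: "\<And>t. set_integrable lborel {0..t} lam"
    and arrivals: "poisson_process M lam T"
    and p_nonneg: "\<And>j. j \<in> {1..J} \<Longrightarrow> 0 \<le> p j"
    and p_sum: "(\<Sum>j=1..J. p j) = 1"
    and batch_measurable: "\<And>i j. j \<in> {1..J} \<Longrightarrow> Sig i j \<in> measurable M (count_space UNIV)"
    and batch_law: "\<And>i. distr M (\<Pi>\<^sub>M j\<in>{1..J}. count_space UNIV) (\<lambda>\<omega>. \<lambda>j\<in>{1..J}. Sig i j \<omega>) = BS"
    and batch_pgf: "\<And>z. (\<And>j. j \<in> {1..J} \<Longrightarrow> z j \<in> {0..1}) \<Longrightarrow>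
          (\<integral>x. (\<Prod>j=1..J. z j ^ x j) \<partial>BS) = prob_gen_fun S (\<Sum>j=1..J. p j * z j)"
    and path_eval: "(\<lambda>(s, x). x s) \<in> measurable (restrict_space borel {0..} \<Otimes>\<^sub>M D) (count_space UNIV)"
    and route_measurable: "\<And>i j l. j \<in> {1..J} \<Longrightarrow> X i j l \<in> measurable M D"
    and route_law: "\<And>i j l k s. \<lbrakk>j \<in> {1..J}; k \<in> {1..J}; 0 \<le> s\<rbrakk> \<Longrightarrow>
          prob {\<omega> \<in> space M. X i j l \<omega> s = k} = qe j k s"
    and independent: "indep_sets (\<lambda>u. sets (source_algebra M J D T Sig X u))
          ({Arrivals} \<union> range Batch \<union> {Route i j l | i j l. j \<in> {1..J}})"

end

theory Submission
  imports Defs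
begin

text \<open>
  Write \<open>N\<^sub>k\<close> for the number of customers in queue \<open>k\<close> at time \<open>t\<close>. The recursion is the coefficient form of a
  differential equation for the joint generating function \<open>H z = E (\<Prod>k. z k ^ N\<^sub>k)\<close> on \<open>[0,1]\<^sup>J\<close>. Given the arrival
  times, customers of different batches move independently, and a batch that arrived at time \<open>\<tau>\<close> multiplies
  \<open>\<Prod>k. z k ^ N\<^sub>k\<close> by a factor of conditional mean \<open>\<phi> \<tau> z = G_S (1 - (\<Sum>k. (1 - z k) * q k (t - \<tau>)))\<close>: a
  customer contributes \<open>z k\<close> if it sits in queue \<open>k\<close> and 1 if it has left. Averaging over the Poisson
  points turns the product of these factors into \<open>H z = exp (\<integral> lam \<tau> * (\<phi> \<tau> z - 1))\<close> (\<open>queue_count_pgf\<close>).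

  For Poisson batches \<open>\<phi> \<tau> z = exp (- mu * (\<Sum>k. q k)) * (\<Prod>k. exp (mu * q k * z k))\<close>, so that \<open>H = exp (A - c)\<close> where
  \<open>c = \<integral> lam\<close> and \<open>A\<close> is a power series whose coefficients \<open>a i\<close> are the integrals in the recursion. Differentiating in
  \<open>z v\<close> gives \<open>H\<^sub>v = A\<^sub>v * H\<close>, and comparing coefficients gives
  \<open>n v * P n = (\<Sum>i. i v * a i * P (n - i))\<close>. The variables of the queues above \<open>v\<close> are set to 0, which forces
  these queues to be empty. If nobody leaves the network, then \<open>(\<Sum>k. q k) = 1\<close> and the exponential in \<open>a i\<close> is \<open>exp (- mu)\<close>.

  Coefficients of several variables are never compared at once. The variable \<open>z v\<close> is treated first
  (\<open>exp_powser_recursion\<close>), with the other variables fixed; then the remaining variables are expanded one at a time, each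
  step being a Cauchy product of power series in one variable. The statement that survives this
  induction is \<open>mixed_recursion\<close>, about quantities that are coefficients in some of the variables and generating functions
  in the others.
\<close>

section \<open>Power series in one variable\<close>

text \<open>
  Probability generating functions are compared on \<open>(0,1)\<close> only, so the identity theorem is
  needed with values on one side of 0. The constant coefficient is the limit at 0 from the right;
  dividing by \<open>x\<close> passes to the next one.
\<close>

lemma powser_eq_imp_coeff_eq:
  fixes c d :: "nat \<Rightarrow> real"
  assumes c: "\<And>x. 0 < x \<Longrightarrow> x < 1 \<Longrightarrow> (\<lambda>n. c n * x ^ n) sums f x"
    and d: "\<And>x. 0 < x \<Longrightarrow> x < 1 \<Longrightarrow> (\<lambda>n. d n * x ^ n) sums f x"
  shows "c n = d n"
proof -
  have vanish: "e n = 0" if "\<And>x. 0 < x \<Longrightarrow> x < 1 \<Longrightarrow> (\<lambda>n. e n * x ^ n) sums 0" for e :: "nat \<Rightarrow> real" and n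
    using that
  proof (induction n arbitrary: e rule: less_induct)
    case (less n)
    have summ: "summable (\<lambda>n. e n * x ^ n)" if "norm x < 1 / 2" for x :: real
      by (rule powser_inside[of _ "1/2"]) (use that less.prems[of "1/2"] in \<open>auto simp: sums_iff\<close>)
    have "((\<lambda>x. \<Sum>n. e n * x ^ n) \<longlongrightarrow> e 0) (at 0)"
      by (rule powser_limit_0[of "1/2"]) (use summ in auto)
    then have "((\<lambda>x. \<Sum>n. e n * x ^ n) \<longlongrightarrow> e 0) (at_right 0)"
      by (rule tendsto_mono[OF at_le, rotated]) auto
    moreover have "eventually (\<lambda>x::real. (\<Sum>n. e n * x ^ n) = 0) (at_right 0)"
      using less.prems by (auto simp: eventually_at_right_field sums_iff intro!: exI[of _ 1])
    ultimately have "((\<lambda>x::real. 0) \<longlongrightarrow> e 0) (at_right 0)"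
      by (rule Lim_transform_eventually)
    then have e0: "e 0 = 0"
      by (simp add: tendsto_const_iff)
    show ?case
    proof (cases n)
      case (Suc m)
      have "e (Suc m) = 0"
      proof (rule less.IH[of m "\<lambda>n. e (Suc n)"])
        fix x :: real assume x: "0 < x" "x < 1"
        have "(\<lambda>n. e (Suc n) * x ^ Suc n) sums 0"
          using less.prems[OF x] e0 by (subst sums_Suc_iff) simp
        then have "(\<lambda>n. inverse x * (e (Suc n) * x ^ Suc n)) sums (inverse x * 0)"
          by (rule sums_mult)
        then show "(\<lambda>n. e (Suc n) * x ^ n) sums 0"
          using x by (simp add: field_simps)
      qed (use Suc in auto)
      then show ?thesis using Suc by simp
    qed (use e0 in simp)
  qed
  have "(\<lambda>n. c n - d n) n = 0"
  proof (rule vanish)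
    show "(\<lambda>n. (c n - d n) * x ^ n) sums 0" if "0 < x" "x < 1" for x
      using sums_diff[OF c[OF that] d[OF that]] by (simp add: algebra_simps)
  qed
  then show ?thesis by simp
qed

lemma powser_mult_sums:
  fixes a b :: "nat \<Rightarrow> real"
  assumes a: "\<And>x. 0 < x \<Longrightarrow> x < 1 \<Longrightarrow> (\<lambda>n. a n * x ^ n) sums A x"
    and b: "\<And>x. 0 < x \<Longrightarrow> x < 1 \<Longrightarrow> (\<lambda>n. b n * x ^ n) sums B x"
    and x: "0 < x" "x < 1"
  shows "(\<lambda>n. (\<Sum>i\<le>n. a i * b (n - i)) * x ^ n) sums (A x * B x)"
proof -
  have y: "0 < (1 + x) / 2" "(1 + x) / 2 < 1" "norm x < norm ((1 + x) / 2)"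
    using x by auto
  have "summable (\<lambda>n. norm (a n * x ^ n))" "summable (\<lambda>n. norm (b n * x ^ n))"
    using a[OF y(1,2)] b[OF y(1,2)] powser_insidea[OF _ y(3)] by (blast dest: sums_summable)+
  then have "(\<lambda>n. \<Sum>i\<le>n. (a i * x ^ i) * (b (n - i) * x ^ (n - i))) sums
      ((\<Sum>n. a n * x ^ n) * (\<Sum>n. b n * x ^ n))"
    by (rule Cauchy_product_sums)
  moreover have "(\<Sum>i\<le>n. (a i * x ^ i) * (b (n - i) * x ^ (n - i))) = (\<Sum>i\<le>n. a i * b (n - i)) * x ^ n" for n
    unfolding sum_distrib_right by (intro sum.cong) (auto simp: power_add[symmetric] ac_simps)
  ultimately show ?thesis
    using a[OF x] b[OF x] by (simp add: sums_iff)
qed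

text \<open>
  The derivative of \<open>H = exp (A - c)\<close> is \<open>A' * H\<close>; the recursion compares coefficients on both
  sides. For \<open>A\<close> a power series with nonnegative coefficients this is Panjer's recursion for a compound Poisson law.
\<close>

lemma exp_powser_recursion:
  fixes h a :: "nat \<Rightarrow> real"
  assumes h: "\<And>x. 0 < x \<Longrightarrow> x < 1 \<Longrightarrow> (\<lambda>n. h n * x ^ n) sums exp (A x - c)"
    and a: "\<And>x. 0 < x \<Longrightarrow> x < 1 \<Longrightarrow> (\<lambda>n. a n * x ^ n) sums A x"
  shows "real n * h n = (\<Sum>i\<le>n. real i * a i * h (n - i))"
proof -
  have deriv: "((\<lambda>x. \<Sum>n. e n * x ^ n) has_real_derivative (\<Sum>n. diffs e n * x ^ n)) (at x)"
       "(\<lambda>n. diffs e n * x ^ n) sums (\<Sum>n. diffs e n * x ^ n)"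
    if e: "\<And>x. 0 < x \<Longrightarrow> x < 1 \<Longrightarrow> (\<lambda>n. e n * x ^ n) sums E x" and x: "0 < x" "x < 1"
    for e E and x :: real
  proof -
    have y: "0 < (1 + x) / 2" "(1 + x) / 2 < 1" "norm x < norm ((1 + x) / 2)"
      using x by auto
    have "summable (\<lambda>n. e n * ((1 + x) / 2) ^ n)"
      using e[OF y(1,2)] by (simp add: sums_iff)
    then show "((\<lambda>x. \<Sum>n. e n * x ^ n) has_real_derivative (\<Sum>n. diffs e n * x ^ n)) (at x)"
      using y(3) by (rule termdiffs_strong)
    have "summable (\<lambda>n. diffs e n * x ^ n)"
    proof (rule termdiff_converges[of x 1])
      show "summable (\<lambda>n. e n * z ^ n)" if z: "norm z < 1" for z
      proof -
        have y: "0 < (1 + \<bar>z\<bar>) / 2" "(1 + \<bar>z\<bar>) / 2 < 1" "norm z < norm ((1 + \<bar>z\<bar>) / 2)"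
          using z by auto
        show ?thesis
          using e[OF y(1,2)] y(3) by (auto intro: powser_inside simp: sums_iff)
      qed
    qed (use x in auto)
    then show "(\<lambda>n. diffs e n * x ^ n) sums (\<Sum>n. diffs e n * x ^ n)" by (rule summable_sums)
  qed
  define A' where "A' = (\<lambda>x. \<Sum>n. diffs a n * x ^ n)"
  have A': "(\<lambda>n. diffs a n * x ^ n) sums A' x" if "0 < x" "x < 1" for x
    unfolding A'_def using deriv(2)[OF a that] .
  have h': "(\<lambda>n. diffs h n * x ^ n) sums (A' x * exp (A x - c))" if x: "0 < x" "x < 1" for x
  proof -
    have "(A has_real_derivative A' x) (at x)"
      unfolding A'_def
      by (rule has_field_derivative_transform_within_open[OF deriv(1)[OF a x], of "{0<..<1}"])
         (use x a in \<open>auto simp: sums_iff\<close>)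
    then have "((\<lambda>x. exp (A x - c)) has_real_derivative (A' x * exp (A x - c))) (at x)"
      by (auto intro!: derivative_eq_intros)
    moreover have "((\<lambda>x. exp (A x - c)) has_real_derivative (\<Sum>n. diffs h n * x ^ n)) (at x)"
      by (rule has_field_derivative_transform_within_open[OF deriv(1)[OF h x], of "{0<..<1}"])
         (use x h in \<open>auto simp: sums_iff\<close>)
    ultimately have "(\<Sum>n. diffs h n * x ^ n) = A' x * exp (A x - c)"
      by (metis DERIV_unique)
    then show ?thesis using deriv(2)[OF h x] by simp
  qed
  have rec: "diffs h m = (\<Sum>i\<le>m. diffs a i * h (m - i))" for m
    by (rule powser_eq_imp_coeff_eq[OF h' powser_mult_sums[OF A' h]])
  show ?thesis
  proof (cases n)
    case (Suc m)
    have "real n * h n = diffs h m" unfolding Suc diffs_def by simp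
    also have "\<dots> = (\<Sum>i\<le>m. real (Suc i) * a (Suc i) * h (n - Suc i))"
      unfolding rec by (simp add: diffs_def Suc)
    also have "\<dots> = (\<Sum>i\<le>n. real i * a i * h (n - i))"
      unfolding Suc by (subst sum.atMost_Suc_shift) simp
    finally show ?thesis .
  qed simp
qed

text \<open>
  The partial sums of a nonnegative series are dominated by its integrable sum.
\<close>

lemma integral_sums_nonneg:
  fixes f :: "nat \<Rightarrow> 'a \<Rightarrow> real"
  assumes [measurable]: "\<And>m. f m \<in> borel_measurable M"
    and nonneg: "\<And>m x. x \<in> space M \<Longrightarrow> 0 \<le> f m x"
    and sums: "\<And>x. x \<in> space M \<Longrightarrow> (\<lambda>m. f m x) sums g x"
    and g: "integrable M g"
  shows "(\<lambda>m. \<integral>x. f m x \<partial>M) sums (\<integral>x. g x \<partial>M)"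
proof -
  have partial: "(\<Sum>m<n. f m x) \<le> g x" if "x \<in> space M" for n x
    using sum_le_suminf[of "\<lambda>m. f m x" "{..<n}"] sums[OF that] nonneg[OF that]
    by (auto simp: sums_iff)
  have single: "f m x \<le> g x" if "x \<in> space M" for m x
    using partial[OF that, of "Suc m"] sum_nonneg[of "{..<m}" "\<lambda>m. f m x"] nonneg[OF that] by fastforce
  have int: "integrable M (f m)" for m
    by (rule Bochner_Integration.integrable_bound[OF g]) (use nonneg single in \<open>force intro!: AE_I2 intro: order_trans[OF _ abs_ge_self]\<close>)+
  have "(\<lambda>n. \<integral>x. (\<Sum>m<n. f m x) \<partial>M) \<longlonglongrightarrow> (\<integral>x. g x \<partial>M)"
  proof (rule integral_dominated_convergence[where w = g])
    show "AE x in M. norm (\<Sum>m<n. f m x) \<le> g x" for n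
      using partial nonneg by (auto intro!: AE_I2 simp: abs_of_nonneg sum_nonneg)
  qed (use g sums in \<open>auto simp: sums_def intro!: AE_I2\<close>)
  then show ?thesis
    by (simp add: sums_def int)
qed


lemma power_div_fact_le_exp:
  fixes x :: real
  assumes "0 \<le> x"
  shows "x ^ n / fact n \<le> exp x"
  using sum_le_suminf[of "\<lambda>n. x ^ n / fact n" "{n}"] summable_exp[of x] exp_converges[of x] assms
  by (auto simp: sums_iff field_simps)

section \<open>Recursion for counts with a compound Poisson generating function\<close>

text \<open>
  The generating function assumed here is that of a vector of counts built from a Poisson number of clusters. A cluster has
  a type \<open>\<tau>\<close> with intensity \<open>W \<tau> * (\<Prod>k. exp (r k \<tau>))\<close>, and within it the counts are independent Poisson
  variables of means \<open>r k \<tau>\<close>. Thus \<open>W\<close> already contains the factor \<open>exp (- (\<Sum>k. r k \<tau>))\<close>, and \<open>c\<close> is the total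
  intensity.
\<close>

locale compound_poisson_counts = prob_space M for M :: "'a measure" +
  fixes N :: "'k \<Rightarrow> 'a \<Rightarrow> nat" and Ks :: "'k set"
    and L :: "'b measure" and W :: "'b \<Rightarrow> real" and r :: "'k \<Rightarrow> 'b \<Rightarrow> real" and c :: real
  assumes finite_Ks: "finite Ks"
    and N_measurable: "\<And>k. k \<in> Ks \<Longrightarrow> N k \<in> measurable M (count_space UNIV)"
    and W_measurable[measurable]: "W \<in> borel_measurable L"
    and r_measurable: "\<And>k. k \<in> Ks \<Longrightarrow> r k \<in> borel_measurable L"
    and W_nonneg: "\<And>\<tau>. 0 \<le> W \<tau>"
    and r_nonneg: "\<And>k \<tau>. k \<in> Ks \<Longrightarrow> 0 \<le> r k \<tau>"
    and integrable_W: "integrable L (\<lambda>\<tau>. W \<tau> * (\<Prod>k\<in>Ks. exp (r k \<tau>)))"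
    and pgf: "\<And>z. (\<And>k. k \<in> Ks \<Longrightarrow> z k \<in> {0..1}) \<Longrightarrow>
      expectation (\<lambda>\<omega>. \<Prod>k\<in>Ks. z k ^ N k \<omega>) = exp ((\<integral>\<tau>. W \<tau> * (\<Prod>k\<in>Ks. exp (r k \<tau> * z k)) \<partial>L) - c)"
begin

text \<open>
  For \<open>k \<in> K\<close> the coefficient of \<open>z k ^ n k\<close> has been extracted; the other variables are still arguments. With
  \<open>K = {}\<close> this is the joint generating function, with \<open>K = Ks\<close> the probability that the counts equal \<open>n\<close>.
  The next definition does the same for the exponent of the generating function.
\<close>

definition mixed_pgf :: "'k set \<Rightarrow> ('k \<Rightarrow> nat) \<Rightarrow> ('k \<Rightarrow> real) \<Rightarrow> real" where
  "mixed_pgf K n z = expectation (\<lambda>\<omega>. \<Prod>k\<in>Ks. if k \<in> K then of_bool (N k \<omega> = n k) else z k ^ N k \<omega>)"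

definition mixed_rate :: "'k set \<Rightarrow> ('k \<Rightarrow> nat) \<Rightarrow> ('k \<Rightarrow> real) \<Rightarrow> real" where
  "mixed_rate K i z = (\<integral>\<tau>. W \<tau> * (\<Prod>k\<in>Ks. if k \<in> K then r k \<tau> ^ i k / fact (i k) else exp (r k \<tau> * z k)) \<partial>L)"

lemma mixed_pgf_cong:
  "\<lbrakk>\<And>k. k \<in> K \<Longrightarrow> n k = n' k; \<And>k. k \<in> Ks - K \<Longrightarrow> z k = z' k\<rbrakk> \<Longrightarrow> mixed_pgf K n z = mixed_pgf K n' z'"
  unfolding mixed_pgf_def by (intro Bochner_Integration.integral_cong prod.cong) auto

text \<open>
  Moving \<open>k\<close> into \<open>K\<close> is passing from a power series in \<open>z k\<close> to its coefficients.
\<close>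

lemma mixed_pgf_sums:
  assumes k: "k \<in> Ks" "k \<notin> K" and z: "\<And>k. k \<in> Ks \<Longrightarrow> z k \<in> {0..1}" and x: "x \<in> {0..1}"
  shows "(\<lambda>m. mixed_pgf (insert k K) (n(k := m)) z * x ^ m) sums mixed_pgf K n (z(k := x))"
proof -
  note [measurable] = N_measurable
  define R where "R = (\<lambda>\<omega>. \<Prod>k'\<in>Ks - {k}. if k' \<in> K then of_bool (N k' \<omega> = n k') else z k' ^ N k' \<omega>)"
  have [measurable]: "R \<in> borel_measurable M"
    unfolding R_def by measurable
  have R: "0 \<le> R \<omega>" "R \<omega> \<le> 1" for \<omega>
    unfolding R_def using z by (intro prod_nonneg prod_le_1; auto intro: power_le_one)+
  have split: "(\<Prod>j\<in>Ks. f j) = f k * (\<Prod>j\<in>Ks - {k}. f j)" for f :: "'k \<Rightarrow> real"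
    using finite_Ks k(1) by (rule prod.remove)
  have pgf_insert: "mixed_pgf (insert k K) (n(k := m)) z * x ^ m
      = expectation (\<lambda>\<omega>. if m = N k \<omega> then R \<omega> * x ^ m else 0)" for m
  proof -
    have "(\<Prod>j\<in>Ks. if j \<in> insert k K then of_bool (N j \<omega> = (n(k := m)) j) else z j ^ N j \<omega>)
        = (if m = N k \<omega> then R \<omega> else 0)" for \<omega>
    proof -
      have "(\<Prod>j\<in>Ks - {k}. if j \<in> insert k K then of_bool (N j \<omega> = (n(k := m)) j) else z j ^ N j \<omega>) = R \<omega>"
        unfolding R_def by (rule prod.cong) auto
      then show ?thesis unfolding split by simp
    qed
    then have "mixed_pgf (insert k K) (n(k := m)) z * x ^ m
        = expectation (\<lambda>\<omega>. (if m = N k \<omega> then R \<omega> else 0) * x ^ m)"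
      unfolding mixed_pgf_def by simp
    also have "\<dots> = expectation (\<lambda>\<omega>. if m = N k \<omega> then R \<omega> * x ^ m else 0)"
      by (intro Bochner_Integration.integral_cong) auto
    finally show ?thesis .
  qed
  have pgf_base: "mixed_pgf K n (z(k := x)) = expectation (\<lambda>\<omega>. R \<omega> * x ^ N k \<omega>)"
  proof -
    have "(\<Prod>j\<in>Ks - {k}. if j \<in> K then of_bool (N j \<omega> = n j) else (z(k := x)) j ^ N j \<omega>) = R \<omega>" for \<omega>
      unfolding R_def by (rule prod.cong) auto
    then show ?thesis
      unfolding mixed_pgf_def split using k by (simp add: mult.commute)
  qed
  show ?thesis
    unfolding pgf_insert pgf_base
  proof (rule integral_sums_nonneg)
    show "integrable M (\<lambda>\<omega>. R \<omega> * x ^ N k \<omega>)"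
      by (rule integrable_const_bound[where B = 1])
         (use R x k in \<open>auto intro!: AE_I2 mult_le_one power_le_one\<close>)
    show "(\<lambda>m. if m = N k \<omega> then R \<omega> * x ^ m else 0) sums (R \<omega> * x ^ N k \<omega>)" for \<omega>
      using sums_single[of "N k \<omega>" "\<lambda>m. R \<omega> * x ^ m"] by simp
  qed (use R x k in auto)
qed

lemma mixed_rate_integrand_le:
  assumes z: "\<And>k. k \<in> Ks \<Longrightarrow> z k \<in> {0..1}"
  shows "norm (W \<tau> * (\<Prod>k\<in>Ks. if k \<in> K then r k \<tau> ^ i k / fact (i k) else exp (r k \<tau> * z k)))
    \<le> norm (W \<tau> * (\<Prod>k\<in>Ks. exp (r k \<tau>)))"
proof -
  have "(if k \<in> K then r k \<tau> ^ i k / fact (i k) else exp (r k \<tau> * z k)) \<le> exp (r k \<tau>)"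
    "0 \<le> (if k \<in> K then r k \<tau> ^ i k / fact (i k) else exp (r k \<tau> * z k))" if "k \<in> Ks" for k
    using z[OF that] r_nonneg[OF that] power_div_fact_le_exp[OF r_nonneg[OF that]]
    by (auto intro: mult_left_le)
  then have "(\<Prod>k\<in>Ks. if k \<in> K then r k \<tau> ^ i k / fact (i k) else exp (r k \<tau> * z k)) \<le> (\<Prod>k\<in>Ks. exp (r k \<tau>))"
    "0 \<le> (\<Prod>k\<in>Ks. if k \<in> K then r k \<tau> ^ i k / fact (i k) else exp (r k \<tau> * z k))"
    by (auto intro!: prod_mono prod_nonneg)
  then show ?thesis
    using W_nonneg by (simp add: abs_mult mult_left_mono)
qed

lemma mixed_rate_sums:
  assumes k: "k \<in> Ks" "k \<notin> K" and z: "\<And>k. k \<in> Ks \<Longrightarrow> z k \<in> {0..1}" and x: "x \<in> {0..1}"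
  shows "(\<lambda>m. mixed_rate (insert k K) (i(k := m)) z * x ^ m) sums mixed_rate K i (z(k := x))"
proof -
  note [measurable] = r_measurable
  define R where "R = (\<lambda>\<tau>. \<Prod>k'\<in>Ks - {k}. if k' \<in> K then r k' \<tau> ^ i k' / fact (i k') else exp (r k' \<tau> * z k'))"
  have [measurable]: "R \<in> borel_measurable L"
    unfolding R_def by measurable
  have R: "0 \<le> R \<tau>" for \<tau>
    unfolding R_def using r_nonneg by (intro prod_nonneg) auto
  have split: "(\<Prod>j\<in>Ks. f j) = f k * (\<Prod>j\<in>Ks - {k}. f j)" for f :: "'k \<Rightarrow> real"
    using finite_Ks k(1) by (rule prod.remove)
  have rate_insert: "mixed_rate (insert k K) (i(k := m)) z * x ^ m
      = (\<integral>\<tau>. W \<tau> * R \<tau> * ((r k \<tau> * x) ^ m / fact m) \<partial>L)" for m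
  proof -
    have "(\<Prod>j\<in>Ks. if j \<in> insert k K then r j \<tau> ^ (i(k := m)) j / fact ((i(k := m)) j) else exp (r j \<tau> * z j))
        = r k \<tau> ^ m / fact m * R \<tau>" for \<tau>
      unfolding split R_def by (rule arg_cong2[where f = "(*)"], simp, rule prod.cong) auto
    then have "mixed_rate (insert k K) (i(k := m)) z * x ^ m
        = (\<integral>\<tau>. (W \<tau> * (r k \<tau> ^ m / fact m * R \<tau>)) * x ^ m \<partial>L)"
      unfolding mixed_rate_def by simp
    also have "\<dots> = (\<integral>\<tau>. W \<tau> * R \<tau> * ((r k \<tau> * x) ^ m / fact m) \<partial>L)"
      by (intro Bochner_Integration.integral_cong) (auto simp: power_mult_distrib)
    finally show ?thesis .
  qed
  have integrand: "W \<tau> * (\<Prod>j\<in>Ks. if j \<in> K then r j \<tau> ^ i j / fact (i j) else exp (r j \<tau> * (z(k := x)) j))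
      = W \<tau> * R \<tau> * exp (r k \<tau> * x)" for \<tau>
  proof -
    have "(\<Prod>j\<in>Ks - {k}. if j \<in> K then r j \<tau> ^ i j / fact (i j) else exp (r j \<tau> * (z(k := x)) j)) = R \<tau>"
      unfolding R_def by (rule prod.cong) auto
    then show ?thesis
      unfolding split using k by simp
  qed
  have rate_base: "mixed_rate K i (z(k := x)) = (\<integral>\<tau>. W \<tau> * R \<tau> * exp (r k \<tau> * x) \<partial>L)"
    unfolding mixed_rate_def integrand ..
  show ?thesis
    unfolding rate_insert rate_base
  proof (rule integral_sums_nonneg)
    show "integrable L (\<lambda>\<tau>. W \<tau> * R \<tau> * exp (r k \<tau> * x))"
      unfolding integrand[symmetric]
    proof (rule Bochner_Integration.integrable_bound[OF integrable_W])
      show "AE \<tau> in L. norm (W \<tau> * (\<Prod>j\<in>Ks. if j \<in> K then r j \<tau> ^ i j / fact (i j) else exp (r j \<tau> * (z(k := x)) j)))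
          \<le> norm (W \<tau> * (\<Prod>j\<in>Ks. exp (r j \<tau>)))"
        by (intro AE_I2 mixed_rate_integrand_le) (use z x in auto)
    qed measurable
    show "(\<lambda>m. W \<tau> * R \<tau> * ((r k \<tau> * x) ^ m / fact m)) sums (W \<tau> * R \<tau> * exp (r k \<tau> * x))" for \<tau>
      using exp_converges[of "r k \<tau> * x"] by (intro sums_mult) (simp add: field_simps)
  qed (use R x k W_nonneg r_nonneg in \<open>auto intro!: mult_nonneg_nonneg divide_nonneg_nonneg zero_le_power\<close>)
qed

text \<open>
  The set \<open>K\<close> grows from \<open>{v}\<close>. For \<open>K = {v}\<close> the claim is the differential equation in
  \<open>z v\<close> alone. In the step both sides are power series in the variable \<open>z k\<close> that is added, and
  the right-hand side is a finite sum of products of two such series; equality of the coefficients of order \<open>n k\<close> is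
  the claim for \<open>insert k K\<close>.
\<close>

theorem mixed_recursion:
  assumes "K \<subseteq> Ks" "v \<in> K" "\<And>k. k \<in> Ks \<Longrightarrow> z k \<in> {0..1}"
  shows "real (n v) * mixed_pgf K n z =
    (\<Sum>i\<in>(\<Pi>\<^sub>E k\<in>K. {..n k}). real (i v) * mixed_rate K i z * mixed_pgf K (\<lambda>k. n k - i k) z)"
proof -
  have finK: "finite K" using assms(1) finite_Ks finite_subset by blast
  have PiE_sum: "(\<Sum>i\<in>(\<Pi>\<^sub>E k\<in>insert a F. {..n k}). f i) = (\<Sum>i\<in>(\<Pi>\<^sub>E k\<in>F. {..n k}). \<Sum>m\<le>n a. f (i(a := m)))"
    if "a \<notin> F" for a and F :: "'k set" and n :: "'k \<Rightarrow> nat" and f :: "('k \<Rightarrow> nat) \<Rightarrow> real"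
  proof -
    have "(\<Sum>i\<in>(\<Pi>\<^sub>E k\<in>insert a F. {..n k}). f i) = (\<Sum>(m, i)\<in>{..n a} \<times> (\<Pi>\<^sub>E k\<in>F. {..n k}). f (i(a := m)))"
      unfolding PiE_insert_eq by (subst sum.reindex[OF inj_combinator[OF that]]) (simp add: case_prod_unfold)
    also have "\<dots> = (\<Sum>i\<in>(\<Pi>\<^sub>E k\<in>F. {..n k}). \<Sum>m\<le>n a. f (i(a := m)))"
      unfolding sum.cartesian_product[symmetric] by (rule sum.swap)
    finally show ?thesis .
  qed
  have main: "real (n v) * mixed_pgf (insert v F) n z =
    (\<Sum>i\<in>(\<Pi>\<^sub>E k\<in>insert v F. {..n k}).
       real (i v) * mixed_rate (insert v F) i z * mixed_pgf (insert v F) (\<lambda>k. n k - i k) z)"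
    if "finite F" "v \<notin> F" "insert v F \<subseteq> Ks" "\<And>k. k \<in> Ks \<Longrightarrow> z k \<in> {0..1}" for F n z
    using that
  proof (induction F arbitrary: n z rule: finite_induct)
    case empty
    \<comment> \<open>only the value at \<open>v\<close> of an index matters for \<open>K = {v}\<close>, so the index is \<open>undefined\<close> elsewhere, as in \<open>PiE\<close>\<close>
    have v: "v \<in> Ks" using assms by auto
    have "(\<lambda>m. mixed_pgf {v} (n(v := m)) z * x ^ m) sums exp (mixed_rate {} (\<lambda>_. undefined) (z(v := x)) - c)"
      if x: "0 < x" "x < 1" for x
    proof -
      have "mixed_pgf {} n (z(v := x)) = exp (mixed_rate {} (\<lambda>_. undefined) (z(v := x)) - c)"
        unfolding mixed_pgf_def mixed_rate_def using pgf[of "z(v := x)"] empty.prems x by auto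
      then show ?thesis
        using mixed_pgf_sums[OF v, of "{}" z x n] empty.prems x by auto
    qed
    moreover have "(\<lambda>m. mixed_rate {v} ((\<lambda>_. undefined)(v := m)) z * x ^ m) sums mixed_rate {} (\<lambda>_. undefined) (z(v := x))"
      if x: "0 < x" "x < 1" for x
      using mixed_rate_sums[OF v, of "{}" z x "\<lambda>_. undefined"] empty.prems x by auto
    ultimately have "real (n v) * mixed_pgf {v} (n(v := n v)) z =
      (\<Sum>m\<le>n v. real m * mixed_rate {v} ((\<lambda>_. undefined)(v := m)) z * mixed_pgf {v} (n(v := n v - m)) z)"
      by (rule exp_powser_recursion)
    moreover have "mixed_pgf {v} (n(v := n v - m)) z = mixed_pgf {v} (\<lambda>k. n k - ((\<lambda>_. undefined)(v := m)) k) z" for m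
      by (rule mixed_pgf_cong) auto
    ultimately show ?case
      by (simp add: PiE_sum fun_upd_def)
  next
    case (insert k F)
    define G where "G = insert v F"
    have k: "k \<in> Ks" "k \<notin> G" "k \<noteq> v" and z: "\<And>k. k \<in> Ks \<Longrightarrow> z k \<in> {0..1}"
      using insert by (auto simp: G_def)
    have IH: "real (n v) * mixed_pgf G n (z(k := x)) =
        (\<Sum>i\<in>(\<Pi>\<^sub>E k\<in>G. {..n k}). real (i v) * (mixed_rate G i (z(k := x)) * mixed_pgf G (\<lambda>k. n k - i k) (z(k := x))))"
      if "0 < x" "x < 1" for x
      unfolding G_def mult.assoc[symmetric]
      by (rule insert.IH) (use insert.prems that in auto)
    have "real (n v) * mixed_pgf (insert k G) (n(k := n k)) z = (\<Sum>i\<in>(\<Pi>\<^sub>E k\<in>G. {..n k}). real (i v) *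
        (\<Sum>m\<le>n k. mixed_rate (insert k G) (i(k := m)) z
           * mixed_pgf (insert k G) ((\<lambda>j. n j - i j)(k := n k - m)) z))"
    proof (rule powser_eq_imp_coeff_eq[where n = "n k" and
          c = "\<lambda>m. real (n v) * mixed_pgf (insert k G) (n(k := m)) z" and
          d = "\<lambda>p. (\<Sum>i\<in>(\<Pi>\<^sub>E k\<in>G. {..n k}). real (i v) *
            (\<Sum>m\<le>p. mixed_rate (insert k G) (i(k := m)) z
              * mixed_pgf (insert k G) ((\<lambda>j. n j - i j)(k := p - m)) z))" and
          f = "\<lambda>x. real (n v) * mixed_pgf G n (z(k := x))"])
      fix x :: real assume x: "0 < x" "x < 1"
      show "(\<lambda>m. real (n v) * mixed_pgf (insert k G) (n(k := m)) z * x ^ m) sums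
          (real (n v) * mixed_pgf G n (z(k := x)))"
        unfolding mult.assoc using x by (intro sums_mult mixed_pgf_sums k z) auto
      show "(\<lambda>p. (\<Sum>i\<in>(\<Pi>\<^sub>E k\<in>G. {..n k}). real (i v) *
            (\<Sum>m\<le>p. mixed_rate (insert k G) (i(k := m)) z
              * mixed_pgf (insert k G) ((\<lambda>j. n j - i j)(k := p - m)) z)) * x ^ p) sums
          (real (n v) * mixed_pgf G n (z(k := x)))"
      proof -
        have "(\<lambda>p. \<Sum>i\<in>(\<Pi>\<^sub>E k\<in>G. {..n k}). real (i v) *
            ((\<Sum>m\<le>p. mixed_rate (insert k G) (i(k := m)) z
              * mixed_pgf (insert k G) ((\<lambda>j. n j - i j)(k := p - m)) z) * x ^ p)) sums
          (real (n v) * mixed_pgf G n (z(k := x)))"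
          unfolding IH[OF x] using x
          by (intro sums_sum sums_mult
              powser_mult_sums[OF mixed_rate_sums[OF k(1,2) z] mixed_pgf_sums[OF k(1,2) z]]) auto
        then show ?thesis
          unfolding mult.assoc[symmetric] sum_distrib_right[symmetric] .
      qed
    qed
    also have "\<dots> = (\<Sum>i\<in>(\<Pi>\<^sub>E k\<in>insert k G. {..n k}).
        real (i v) * mixed_rate (insert k G) i z * mixed_pgf (insert k G) (\<lambda>k. n k - i k) z)"
      unfolding PiE_sum[OF k(2)] sum_distrib_left using k(3)
      by (intro sum.cong refl) (auto simp: mult.assoc intro!: arg_cong2[where f = "(*)"] mixed_pgf_cong)
    finally show ?case
      by (simp add: G_def insert_commute)
  qed
  show ?thesis
    using main[of "K - {v}" z n] assms finK by (simp add: insert_absorb)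
qed

end

section \<open>Products over the points of a Poisson process\<close>

lemma expectation_power_poisson_law:
  assumes "0 \<le> m"
  shows "measure_pmf.expectation (poisson_law m) (\<lambda>n. z ^ n) = exp (m * (z - 1))"
    and "integrable (measure_pmf (poisson_law m)) (\<lambda>n. z ^ n)"
proof -
  have sums: "(\<lambda>n. z ^ n * pmf (poisson_law m) n) sums (exp (m * z) * exp (- m))" for z :: real
  proof -
    have "(\<lambda>n. (m * z) ^ n /\<^sub>R fact n * exp (- m)) sums (exp (m * z) * exp (- m))"
      by (intro sums_mult2 exp_converges)
    then show ?thesis
      by (simp add: pmf_poisson_law[OF assms] power_mult_distrib field_simps)
  qed
  have norm: "norm (pmf (poisson_law m) n *\<^sub>R z ^ n) = \<bar>z\<bar> ^ n * pmf (poisson_law m) n" for n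
    by (simp add: abs_mult power_abs)
  have "integrable (count_space UNIV) (\<lambda>n. pmf (poisson_law m) n *\<^sub>R z ^ n)"
    unfolding integrable_count_space_nat_iff norm using sums[of "\<bar>z\<bar>"] by (rule sums_summable)
  then show int: "integrable (measure_pmf (poisson_law m)) (\<lambda>n. z ^ n)"
    unfolding measure_pmf_eq_density by (subst integrable_density) auto
  have "measure_pmf.expectation (poisson_law m) (\<lambda>n. z ^ n)
      = (\<integral>n. pmf (poisson_law m) n *\<^sub>R z ^ n \<partial>count_space UNIV)"
    unfolding measure_pmf_eq_density by (subst integral_density) auto
  also have "\<dots> = (\<Sum>n. pmf (poisson_law m) n *\<^sub>R z ^ n)"
    by (rule integral_count_space_nat) fact
  also have "\<dots> = exp (m * z) * exp (- m)"
    using sums[of z] by (simp add: sums_iff mult.commute)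
  finally show "measure_pmf.expectation (poisson_law m) (\<lambda>n. z ^ n) = exp (m * (z - 1))"
    by (simp add: exp_add[symmetric] algebra_simps)
qed


lemma tendsto_prod_initial_segments:
  fixes h :: "nat \<Rightarrow> real"
  assumes "finite I"
  shows "(\<lambda>m. \<Prod>i<m. if i \<in> I then h i else 1) \<longlonglongrightarrow> (\<Prod>i\<in>I. h i)"
proof (rule tendsto_eventually)
  from assms obtain b where b: "I \<subseteq> {..<b}" using finite_nat_iff_bounded by blast
  show "\<forall>\<^sub>F m in sequentially. (\<Prod>i<m. if i \<in> I then h i else 1) = (\<Prod>i\<in>I. h i)"
    using eventually_ge_at_top[of b]
  proof eventually_elim
    case (elim m)
    then have "{..<m} \<inter> I = I" using b by auto
    then show ?case by (simp add: prod.inter_restrict[symmetric])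
  qed
qed

text \<open>
  A product over a random set is 1 where the set is infinite; elsewhere it is the limit of the
  products over initial segments.
\<close>

lemma borel_measurable_prod_random_set:
  fixes h :: "nat \<Rightarrow> 'a \<Rightarrow> real" and I :: "'a \<Rightarrow> nat set"
  assumes h[measurable]: "\<And>i. h i \<in> borel_measurable M"
    and I[measurable]: "\<And>i. Measurable.pred M (\<lambda>\<omega>. i \<in> I \<omega>)"
  shows "(\<lambda>\<omega>. \<Prod>i\<in>I \<omega>. h i \<omega>) \<in> borel_measurable M"
proof -
  have "(\<Prod>i\<in>I \<omega>. h i \<omega>) = (if \<exists>b. \<forall>i. i \<in> I \<omega> \<longrightarrow> i < b
      then lim (\<lambda>m. \<Prod>i<m. if i \<in> I \<omega> then h i \<omega> else 1) else 1)" for \<omega>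
  proof (cases "finite (I \<omega>)")
    case True
    then show ?thesis
      using limI[OF tendsto_prod_initial_segments[OF True, of "\<lambda>i. h i \<omega>"]]
      by (auto simp: finite_nat_iff_bounded subset_eq)
  next
    case False
    then show ?thesis by (auto simp: finite_nat_iff_bounded subset_eq)
  qed
  then show ?thesis by simp
qed

text \<open>
  A function with finitely many values sees the points only through the numbers of points in its level
  sets, which are what the definition of a Poisson process describes.
\<close>

lemma prod_levels_eq_prod_power:
  fixes T :: "nat \<Rightarrow> 'a \<Rightarrow> ereal"
  assumes fin: "finite {i. T i \<omega> \<le> ereal t}" and nonneg: "\<And>i. 0 \<le> T i \<omega>"
    and key: "\<And>x. x \<in> {0..t} \<Longrightarrow> key x \<in> C" and "finite C"
  shows "(\<Prod>i\<in>{i. T i \<omega> \<le> ereal t}. g (key (real_of_ereal (T i \<omega>))))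
    = (\<Prod>c\<in>C. g c ^ point_count T {x\<in>{0..t}. key x = c} \<omega>)"
proof -
  let ?I = "{i. T i \<omega> \<le> ereal t}"
  have I: "i \<in> ?I \<longleftrightarrow> T i \<omega> \<in> ereal ` {0..t}" for i
    using nonneg[of i] by (cases "T i \<omega>") auto
  have "(\<Prod>i\<in>?I. g (key (real_of_ereal (T i \<omega>))))
      = (\<Prod>c\<in>C. \<Prod>i\<in>{i \<in> ?I. key (real_of_ereal (T i \<omega>)) = c}. g (key (real_of_ereal (T i \<omega>))))"
    by (rule prod.group[symmetric]) (use fin \<open>finite C\<close> key I in auto)
  also have "\<dots> = (\<Prod>c\<in>C. g c ^ point_count T {x\<in>{0..t}. key x = c} \<omega>)"
  proof (rule prod.cong[OF refl])
    fix c
    have "{i \<in> ?I. key (real_of_ereal (T i \<omega>)) = c} = {i. T i \<omega> \<in> ereal ` {x\<in>{0..t}. key x = c}}"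
      using I by auto
    moreover have "(\<Prod>i\<in>{i \<in> ?I. key (real_of_ereal (T i \<omega>)) = c}. g (key (real_of_ereal (T i \<omega>))))
        = g c ^ card {i \<in> ?I. key (real_of_ereal (T i \<omega>)) = c}"
      by simp
    ultimately show "(\<Prod>i\<in>{i \<in> ?I. key (real_of_ereal (T i \<omega>)) = c}. g (key (real_of_ereal (T i \<omega>))))
        = g c ^ point_count T {x\<in>{0..t}. key x = c} \<omega>"
      unfolding point_count_def by simp
  qed
  finally show ?thesis .
qed

context prob_space
begin

lemma poisson_process_expectation_prod_step:
  fixes T :: "nat \<Rightarrow> 'a \<Rightarrow> ereal" and lam :: "real \<Rightarrow> real" and t :: real
    and key :: "real \<Rightarrow> nat" and g :: "nat \<Rightarrow> real"
  assumes T: "poisson_process M lam T"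
    and lam_nonneg: "\<And>s. 0 \<le> s \<Longrightarrow> 0 \<le> lam s"
    and lam: "set_integrable lborel {0..t} lam"
    and key[measurable]: "key \<in> measurable borel (count_space UNIV)"
    and key_less: "\<And>x. key x < b"
  shows "expectation (\<lambda>\<omega>. \<Prod>i\<in>{i. T i \<omega> \<le> ereal t}. g (key (real_of_ereal (T i \<omega>))))
    = exp (LBINT \<tau>:{0..t}. lam \<tau> * (g (key \<tau>) - 1))"
proof -
  define B where "B = (\<lambda>c. {x\<in>{0..t}. key x = c})"
  have B_sets[measurable]: "B c \<in> sets borel" for c
    unfolding B_def by measurable
  have B_sub: "B c \<subseteq> {0..t}" for c
    unfolding B_def by auto
  define \<Lambda> where "\<Lambda> = (\<lambda>c. LBINT s:B c. lam s)"
  have lam_B: "set_integrable lborel (B c) lam" for c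
    by (rule set_integrable_subset[OF lam]) (use B_sub in auto)
  have \<Lambda>_nonneg: "0 \<le> \<Lambda> c" for c
    unfolding \<Lambda>_def set_lebesgue_integral_def
    by (rule integral_nonneg_AE) (use B_sub lam_nonneg in \<open>fastforce simp: indicator_def\<close>)
  have meas[measurable]: "point_count T (B c) \<in> measurable M (count_space UNIV)" for c
    using T B_sub unfolding poisson_process_def by (metis B_sets)
  have law: "distr M (count_space UNIV) (point_count T (B c)) = measure_pmf (poisson_law (\<Lambda> c))" for c
    using T B_sub unfolding poisson_process_def \<Lambda>_def by (metis B_sets)
  have E_power: "expectation (\<lambda>\<omega>. g c ^ point_count T (B c) \<omega>) = exp (\<Lambda> c * (g c - 1))"
    "integrable M (\<lambda>\<omega>. g c ^ point_count T (B c) \<omega>)" for c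
  proof -
    show "expectation (\<lambda>\<omega>. g c ^ point_count T (B c) \<omega>) = exp (\<Lambda> c * (g c - 1))"
      using integral_distr[OF meas[of c], of "\<lambda>n. g c ^ n"] expectation_power_poisson_law(1)[OF \<Lambda>_nonneg]
      by (simp add: law)
    show "integrable M (\<lambda>\<omega>. g c ^ point_count T (B c) \<omega>)"
      using integrable_distr[OF meas[of c], of "\<lambda>n. g c ^ n"] expectation_power_poisson_law(2)[OF \<Lambda>_nonneg]
      by (simp add: law)
  qed
  have "disjoint_family_on B {..<b}"
    by (auto simp: disjoint_family_on_def B_def)
  then have "indep_vars (\<lambda>_. count_space UNIV) (\<lambda>c. point_count T (B c)) {..<b}"
    using T B_sub B_sets unfolding poisson_process_def by metis
  then have indep: "indep_vars (\<lambda>_. borel) (\<lambda>c \<omega>. g c ^ point_count T (B c) \<omega>) {..<b}"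
    by (rule indep_vars_compose2) auto
  have "AE \<omega> in M. finite {i. T i \<omega> \<le> ereal t}"
    using T by (simp add: poisson_process_def)
  then have "expectation (\<lambda>\<omega>. \<Prod>i\<in>{i. T i \<omega> \<le> ereal t}. g (key (real_of_ereal (T i \<omega>))))
      = expectation (\<lambda>\<omega>. \<Prod>c<b. g c ^ point_count T (B c) \<omega>)"
  proof (intro integral_cong_AE)
    show "(\<lambda>\<omega>. \<Prod>i\<in>{i. T i \<omega> \<le> ereal t}. g (key (real_of_ereal (T i \<omega>)))) \<in> borel_measurable M"
    proof (rule borel_measurable_prod_random_set)
      have [measurable]: "T i \<in> borel_measurable M" for i
        using T by (simp add: poisson_process_def)
      show "(\<lambda>\<omega>. g (key (real_of_ereal (T i \<omega>)))) \<in> borel_measurable M" for i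
        by measurable
      show "Measurable.pred M (\<lambda>\<omega>. i \<in> {i. T i \<omega> \<le> ereal t})" for i
        by simp
    qed
    show "AE \<omega> in M. (\<Prod>i\<in>{i. T i \<omega> \<le> ereal t}. g (key (real_of_ereal (T i \<omega>))))
        = (\<Prod>c<b. g c ^ point_count T (B c) \<omega>)"
      if "AE \<omega> in M. finite {i. T i \<omega> \<le> ereal t}"
      using that AE_space
    proof eventually_elim
      case (elim \<omega>)
      then have "0 \<le> T i \<omega>" for i using T by (simp add: poisson_process_def)
      then show ?case
        unfolding B_def by (intro prod_levels_eq_prod_power elim(1)) (use key_less in auto)
    qed
  qed measurable
  also have "\<dots> = (\<Prod>c<b. exp (\<Lambda> c * (g c - 1)))"
    by (subst indep_vars_lebesgue_integral[OF _ indep]) (auto simp: E_power)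
  also have "\<dots> = exp (\<Sum>c<b. LBINT \<tau>:B c. lam \<tau> * (g c - 1))"
    by (simp add: exp_sum \<Lambda>_def)
  also have "(\<Sum>c<b. LBINT \<tau>:B c. lam \<tau> * (g c - 1)) = (LBINT \<tau>:{0..t}. lam \<tau> * (g (key \<tau>) - 1))"
  proof -
    have "(\<Sum>c<b. LBINT \<tau>:B c. lam \<tau> * (g c - 1))
        = (\<integral>\<tau>. (\<Sum>c<b. indicator (B c) \<tau> *\<^sub>R (lam \<tau> * (g c - 1))) \<partial>lborel)"
      unfolding set_lebesgue_integral_def
    proof (rule Bochner_Integration.integral_sum[symmetric])
      show "integrable lborel (\<lambda>\<tau>. indicator (B c) \<tau> *\<^sub>R (lam \<tau> * (g c - 1)))" for c
        using set_integrable_mult_left[of "g c - 1" lborel "B c" lam] lam_B[of c] unfolding set_integrable_def by simp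
    qed
    also have "\<dots> = (LBINT \<tau>:{0..t}. lam \<tau> * (g (key \<tau>) - 1))"
      unfolding set_lebesgue_integral_def
    proof (rule Bochner_Integration.integral_cong[OF refl])
      fix \<tau>
      have "(\<Sum>c<b. indicator (B c) \<tau> *\<^sub>R (lam \<tau> * (g c - 1)))
          = (\<Sum>c<b. if c = key \<tau> then indicator {0..t} \<tau> *\<^sub>R (lam \<tau> * (g c - 1)) else 0)"
        by (intro sum.cong) (auto simp: B_def indicator_def)
      then show "(\<Sum>c<b. indicator (B c) \<tau> *\<^sub>R (lam \<tau> * (g c - 1)))
          = indicator {0..t} \<tau> *\<^sub>R (lam \<tau> * (g (key \<tau>) - 1))"
        using key_less by simp
    qed
    finally show ?thesis .
  qed
  finally show ?thesis .
qed

text \<open>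
  This is the Laplace functional of the Poisson process. For a step function, independence of the counts on its level
  sets gives a product of Poisson generating functions. In general \<open>f\<close> is rounded down to multiples of
  \<open>1 / (R + 1)\<close> and \<open>R\<close> tends to infinity under both integrals, which are dominated by 1 and by \<open>lam\<close>.
\<close>

theorem poisson_process_expectation_prod:
  fixes T :: "nat \<Rightarrow> 'a \<Rightarrow> ereal" and lam f :: "real \<Rightarrow> real" and t :: real
  assumes T: "poisson_process M lam T"
    and lam_nonneg: "\<And>s. 0 \<le> s \<Longrightarrow> 0 \<le> lam s"
    and lam: "set_integrable lborel {0..t} lam"
    and f[measurable]: "f \<in> borel_measurable borel" and f_range: "\<And>x. f x \<in> {0..1}"
  shows "expectation (\<lambda>\<omega>. \<Prod>i\<in>{i. T i \<omega> \<le> ereal t}. f (real_of_ereal (T i \<omega>)))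
    = exp (LBINT \<tau>:{0..t}. lam \<tau> * (f \<tau> - 1))"
proof -
  define g where "g = (\<lambda>R x. real (nat \<lfloor>real (Suc R) * f x\<rfloor>) / real (Suc R))"
  have g_floor: "g R x = of_int \<lfloor>real (Suc R) * f x\<rfloor> / real (Suc R)" for R x
    using f_range[of x] by (simp add: g_def)
  have g_le: "g R x \<le> f x" and g_ge: "f x - 1 / real (Suc R) \<le> g R x" for R x
  proof -
    have "of_int \<lfloor>real (Suc R) * f x\<rfloor> / real (Suc R) \<le> real (Suc R) * f x / real (Suc R)"
      by (intro divide_right_mono) linarith+
    then show "g R x \<le> f x" by (simp add: g_floor)
    have "(real (Suc R) * f x - 1) / real (Suc R) \<le> of_int \<lfloor>real (Suc R) * f x\<rfloor> / real (Suc R)"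
      by (intro divide_right_mono) linarith+
    then show "f x - 1 / real (Suc R) \<le> g R x" by (simp add: g_floor diff_divide_distrib)
  qed
  have g_nonneg: "0 \<le> g R x" for R x
    unfolding g_def by simp
  have g_lim: "(\<lambda>R. g R x) \<longlonglongrightarrow> f x" for x
  proof (rule tendsto_sandwich[OF always_eventually always_eventually _ tendsto_const])
    show "(\<lambda>R. f x - 1 / real (Suc R)) \<longlonglongrightarrow> f x"
      using tendsto_diff[OF tendsto_const LIMSEQ_inverse_real_of_nat] by (simp add: inverse_eq_divide)
  qed (use g_le g_ge in auto)
  have [measurable]: "T i \<in> borel_measurable M" for i
    using T by (simp add: poisson_process_def)
  have [measurable]: "g R \<in> borel_measurable borel" for R
    unfolding g_def by measurable
  have prod_measurable: "(\<lambda>\<omega>. \<Prod>i\<in>{i. T i \<omega> \<le> ereal t}. h (real_of_ereal (T i \<omega>))) \<in> borel_measurable M"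
    if [measurable]: "h \<in> borel_measurable borel" for h :: "real \<Rightarrow> real"
    by (rule borel_measurable_prod_random_set) auto
  have "(\<lambda>R. expectation (\<lambda>\<omega>. \<Prod>i\<in>{i. T i \<omega> \<le> ereal t}. g R (real_of_ereal (T i \<omega>))))
     \<longlonglongrightarrow> expectation (\<lambda>\<omega>. \<Prod>i\<in>{i. T i \<omega> \<le> ereal t}. f (real_of_ereal (T i \<omega>)))"
  proof (rule integral_dominated_convergence[where w = "\<lambda>_. 1"])
    show "AE \<omega> in M. norm (\<Prod>i\<in>{i. T i \<omega> \<le> ereal t}. g R (real_of_ereal (T i \<omega>))) \<le> 1" for R
      using order_trans[OF g_le] f_range g_nonneg by (intro AE_I2) (auto simp: abs_prod intro!: prod_le_1)
  qed (auto intro!: prod_measurable tendsto_prod g_lim)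
  moreover have "(\<lambda>R. exp (LBINT \<tau>:{0..t}. lam \<tau> * (g R \<tau> - 1))) \<longlonglongrightarrow> exp (LBINT \<tau>:{0..t}. lam \<tau> * (f \<tau> - 1))"
  proof (rule tendsto_exp)
    define l where "l = (\<lambda>x. indicator {0..t} x *\<^sub>R lam x)"
    have l: "integrable lborel l"
      using lam by (simp add: set_integrable_def l_def)
    then have [measurable]: "l \<in> borel_measurable borel"
      by (simp add: borel_measurable_integrable flip: measurable_lborel2)
    have scale: "indicator {0..t} x *\<^sub>R (lam x * y) = l x * y" for x y
      by (simp add: l_def)
    have bound: "norm (l x * (g R x - 1)) \<le> norm (l x)" for R x
    proof -
      have "\<bar>g R x - 1\<bar> \<le> 1"
        using g_le[of R x] g_nonneg[of R x] f_range[of x] by auto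
      then show ?thesis unfolding norm_mult by (intro mult_left_le) auto
    qed
    show "(\<lambda>R. LBINT \<tau>:{0..t}. lam \<tau> * (g R \<tau> - 1)) \<longlonglongrightarrow> (LBINT \<tau>:{0..t}. lam \<tau> * (f \<tau> - 1))"
      unfolding set_lebesgue_integral_def scale
      by (rule integral_dominated_convergence[where w = "\<lambda>x. norm (l x)"])
         (use bound l in \<open>auto intro!: AE_I2 tendsto_intros g_lim\<close>)
  qed
  moreover have "expectation (\<lambda>\<omega>. \<Prod>i\<in>{i. T i \<omega> \<le> ereal t}. g R (real_of_ereal (T i \<omega>)))
      = exp (LBINT \<tau>:{0..t}. lam \<tau> * (g R \<tau> - 1))" for R
    unfolding g_def
  proof (rule poisson_process_expectation_prod_step[OF T lam_nonneg lam, where b = "Suc (Suc R)"])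
    show "nat \<lfloor>real (Suc R) * f x\<rfloor> < Suc (Suc R)" for x
    proof -
      have "real (Suc R) * f x \<le> real (Suc R)"
        using f_range[of x] by (intro mult_left_le) auto
      then show ?thesis by linarith
    qed
  qed simp_all
  ultimately show ?thesis
    by (simp add: LIMSEQ_unique)
qed

end

section \<open>Averaging over batches and routes\<close>

text \<open>
  A position outside \<open>{1..J}\<close> belongs to a customer who has left and must not affect the generating function.
\<close>

definition position_weight :: "nat \<Rightarrow> (nat \<Rightarrow> real) \<Rightarrow> nat \<Rightarrow> real" where
  "position_weight J z k = (if k \<in> {1..J} then z k else 1)"

lemma position_weight_range:
  "(\<And>k. k \<in> {1..J} \<Longrightarrow> z k \<in> {0..1}) \<Longrightarrow> position_weight J z k \<in> {0..1}"
  by (auto simp: position_weight_def)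

lemma position_weight_eq_sum:
  "position_weight J z x = 1 - (\<Sum>k=1..J. (1 - z k) * indicator {k} x)"
proof -
  have "(\<Sum>k=1..J. (1 - z k) * indicator {k} x) = (\<Sum>k=1..J. if k = x then 1 - z k else 0)"
    by (intro sum.cong) (auto simp: indicator_def)
  then show ?thesis by (simp add: position_weight_def)
qed

lemma prod_power_queue_count:
  assumes fin: "finite {i. T i \<omega> \<le> ereal t}"
  shows "(\<Prod>k=1..J. z k ^ queue_count J T Sig X t k \<omega>)
    = (\<Prod>i\<in>{i. T i \<omega> \<le> ereal t}. \<Prod>j=1..J. \<Prod>l<Sig i j \<omega>.
        position_weight J z (X i j l \<omega> (t - real_of_ereal (T i \<omega>))))"
proof -
  let ?I = "{i. T i \<omega> \<le> ereal t}"
  define C where "C = (SIGMA i:?I. SIGMA j:{1..J}. {..<Sig i j \<omega>})"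
  define pos where "pos = (\<lambda>(i, j, l). X i j l \<omega> (t - real_of_ereal (T i \<omega>)))"
  have finC: "finite C"
    unfolding C_def using fin by (intro finite_SigmaI) auto
  have count: "queue_count J T Sig X t k \<omega> = card {x \<in> C. pos x = k}" for k
    unfolding queue_count_def C_def pos_def by (rule arg_cong[where f = card]) auto
  have "(\<Prod>i\<in>?I. \<Prod>j=1..J. \<Prod>l<Sig i j \<omega>. position_weight J z (X i j l \<omega> (t - real_of_ereal (T i \<omega>))))
      = (\<Prod>x\<in>C. position_weight J z (pos x))"
    unfolding C_def pos_def using fin by (simp add: prod.Sigma case_prod_unfold)
  also have "\<dots> = (\<Prod>x\<in>C. \<Prod>k=1..J. if pos x = k then z k else 1)"
    by (rule prod.cong) (auto simp: position_weight_def)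
  also have "\<dots> = (\<Prod>k=1..J. \<Prod>x\<in>C. if pos x = k then z k else 1)"
    by (rule prod.swap)
  also have "\<dots> = (\<Prod>k=1..J. z k ^ queue_count J T Sig X t k \<omega>)"
    unfolding count by (intro prod.cong refl, subst prod.inter_filter[OF finC, symmetric]) (rule prod_constant)
  finally show ?thesis ..
qed

text \<open>
  The upper limit of the product and its factors may depend on \<open>m\<close> at the same time, since all but finitely many
  factors are 1.
\<close>

lemma tendsto_prod_truncated:
  fixes h :: "nat \<Rightarrow> nat \<Rightarrow> real"
  assumes fin: "finite I" and h: "\<And>i. i \<in> I \<Longrightarrow> (\<lambda>m. h m i) \<longlonglongrightarrow> f i"
    and one: "\<And>m i. i \<notin> I \<Longrightarrow> h m i = 1"
  shows "(\<lambda>m. \<Prod>i<m. h m i) \<longlonglongrightarrow> (\<Prod>i\<in>I. f i)"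
proof -
  from fin obtain b where b: "I \<subseteq> {..<b}" using finite_nat_iff_bounded by blast
  have "(\<lambda>m. \<Prod>i\<in>I. h m i) \<longlonglongrightarrow> (\<Prod>i\<in>I. f i)"
    by (rule tendsto_prod) (rule h)
  moreover have "\<forall>\<^sub>F m in sequentially. (\<Prod>i\<in>I. h m i) = (\<Prod>i<m. h m i)"
    using eventually_ge_at_top[of b]
  proof eventually_elim
    case (elim m)
    then show ?case using b one by (intro prod.mono_neutral_left) auto
  qed
  ultimately show ?thesis by (rule Lim_transform_eventually)
qed

lemma tendsto_prod_lessThan_truncated:
  fixes f :: "nat \<Rightarrow> nat \<Rightarrow> real" and d :: "nat \<Rightarrow> nat"
  assumes "finite A"
  shows "(\<lambda>m. \<Prod>j\<in>A. \<Prod>l<m. if l < d j then f j l else 1) \<longlonglongrightarrow> (\<Prod>j\<in>A. \<Prod>l<d j. f j l)"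
proof (rule tendsto_prod, rule tendsto_eventually)
  fix j
  show "\<forall>\<^sub>F m in sequentially. (\<Prod>l<m. if l < d j then f j l else 1) = (\<Prod>l<d j. f j l)"
    using eventually_ge_at_top[of "d j"]
  proof eventually_elim
    case (elim m)
    then show ?case by (intro prod.mono_neutral_cong_right) auto
  qed
qed

context batch_network
begin

abbreviation "sources \<equiv> {Arrivals} \<union> range Batch \<union> {Route i j l | i j l. j \<in> {1..J}}"
abbreviation "salg \<equiv> source_algebra M J D T Sig X"

lemma T_measurable[measurable]: "T i \<in> borel_measurable M"
  using arrivals by (simp add: poisson_process_def)

lemma T_nonneg: "\<omega> \<in> space M \<Longrightarrow> 0 \<le> T i \<omega>"
  using arrivals by (simp add: poisson_process_def)

lemma AE_finite_points: "AE \<omega> in M. finite {i. T i \<omega> \<le> ereal t}"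
  using arrivals by (simp add: poisson_process_def)

lemma space_salg: "space (salg u) = space M"
  by (cases u) (auto simp: source_algebra_def)

lemma ident_measurable_salg: "u \<in> sources \<Longrightarrow> (\<lambda>\<omega>. \<omega>) \<in> measurable M (salg u)"
proof -
  assume "u \<in> sources"
  then have sub: "sets (salg u) \<subseteq> sets M"
    using independent unfolding indep_sets_def by blast
  show "(\<lambda>\<omega>. \<omega>) \<in> measurable M (salg u)"
  proof (rule measurableI)
    fix A assume A: "A \<in> sets (salg u)"
    then have "(\<lambda>\<omega>. \<omega>) -` A \<inter> space M = A"
      using sets.sets_into_space[OF A] by (auto simp: space_salg)
    then show "(\<lambda>\<omega>. \<omega>) -` A \<inter> space M \<in> sets M" using A sub by auto
  qed (simp add: space_salg)
qed

lemma T_measurable_salg: "T i \<in> borel_measurable (salg Arrivals)"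
proof -
  have "(\<lambda>\<omega> i. T i \<omega>) \<in> measurable (salg Arrivals) (\<Pi>\<^sub>M i\<in>UNIV. borel)"
    unfolding source_algebra_def source.case by (rule measurable_vimage_algebra1) (auto simp: space_PiM)
  from measurable_compose[OF this measurable_component_singleton[of i]] show ?thesis by simp
qed

lemma Sig_measurable_salg:
  assumes "j \<in> {1..J}"
  shows "Sig i j \<in> measurable (salg (Batch i)) (count_space UNIV)"
proof -
  have "(\<lambda>\<omega>. \<lambda>j\<in>{1..J}. Sig i j \<omega>) \<in> measurable (salg (Batch i)) (\<Pi>\<^sub>M j\<in>{1..J}. count_space UNIV)"
    unfolding source_algebra_def source.case by (rule measurable_vimage_algebra1) (auto simp: space_PiM)
  from measurable_compose[OF this measurable_component_singleton[OF assms]] show ?thesis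
    using assms by simp
qed

lemma X_measurable_salg:
  assumes "j \<in> {1..J}"
  shows "X i j l \<in> measurable (salg (Route i j l)) D"
  unfolding source_algebra_def source.case
  by (rule measurable_vimage_algebra1) (use measurable_space[OF route_measurable[OF assms]] in auto)

text \<open>
  Elapsed times are cut off at 0 so that path evaluation, which is measurable for nonnegative times only,
  becomes measurable without a side condition.
\<close>

lemma position_measurable: "(\<lambda>(s, x). x (max 0 s)) \<in> measurable (borel \<Otimes>\<^sub>M D) (count_space UNIV)"
proof -
  have "(\<lambda>(s :: real, x). (max 0 s, x)) \<in> measurable (borel \<Otimes>\<^sub>M D) (restrict_space borel {0..} \<Otimes>\<^sub>M D)"
    unfolding case_prod_unfold
    by (intro measurable_Pair measurable_restrict_space2) (auto simp: le_max_iff_disj)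
  from measurable_compose[OF this path_eval] show ?thesis
    by (simp add: case_prod_unfold)
qed

lemma X_measurable_position:
  assumes [measurable]: "f \<in> borel_measurable N" "g \<in> measurable N M" and "j \<in> {1..J}"
  shows "(\<lambda>y. X i j l (g y) (max 0 (f y))) \<in> measurable N (count_space UNIV)"
proof -
  have "(\<lambda>y. (f y, X i j l (g y))) \<in> measurable N (borel \<Otimes>\<^sub>M D)"
    using route_measurable[OF assms(3)] by measurable
  from measurable_compose[OF this position_measurable] show ?thesis by simp
qed

text \<open>
  Customers are numbered by natural numbers through a pairing function, so that the queue count is the
  cardinality of a random set of natural numbers.
\<close>

lemma queue_count_measurable: "queue_count J T Sig X t k \<in> measurable M (count_space UNIV)"
proof -
  define S where "S = (\<lambda>\<omega>. {n. case map_prod id prod_decode (prod_decode n) of (i, j, l) \<Rightarrow>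
      j \<in> {1..J} \<and> l < Sig i j \<omega> \<and> T i \<omega> \<le> ereal t \<and> X i j l \<omega> (max 0 (t - real_of_ereal (T i \<omega>))) = k})"
  have decode: "prod_encode (i, prod_encode (j, l)) = n"
    if "map_prod id prod_decode (prod_decode n) = (i, j, l)" for n i j l
    using that by (cases "prod_decode n") (auto, metis prod_decode_inverse)
  have "queue_count J T Sig X t k \<omega> = card (S \<omega>)" if \<omega>: "\<omega> \<in> space M" for \<omega>
  proof -
    have nonneg: "max 0 (t - real_of_ereal (T i \<omega>)) = t - real_of_ereal (T i \<omega>)" if "T i \<omega> \<le> ereal t" for i
      using that T_nonneg[OF \<omega>, of i] by (cases "T i \<omega>") auto
    show ?thesis
      unfolding queue_count_def
    proof (rule bij_betw_same_card[of "\<lambda>(i, j, l). prod_encode (i, prod_encode (j, l))"], rule bij_betwI)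
      show "(\<lambda>n. map_prod id prod_decode (prod_decode n)) \<in> S \<omega> \<rightarrow>
          {(i, j, l). j \<in> {1..J} \<and> l < Sig i j \<omega> \<and> T i \<omega> \<le> ereal t \<and>
                      X i j l \<omega> (t - real_of_ereal (T i \<omega>)) = k}"
        by (auto simp: S_def nonneg split: prod.splits)
    qed (auto simp: S_def nonneg split: prod.splits dest: decode)
  qed
  moreover have "(\<lambda>\<omega>. card (S \<omega>)) \<in> measurable M (count_space UNIV)"
  proof (rule measurable_card)
    fix n
    obtain i j l where n: "map_prod id prod_decode (prod_decode n) = (i, j, l)"
      by (metis prod_cases3)
    have n_iff: "n \<in> S \<omega> \<longleftrightarrow> j \<in> {1..J} \<and> l < Sig i j \<omega> \<and> T i \<omega> \<le> ereal t \<and>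
        X i j l \<omega> (max 0 (t - real_of_ereal (T i \<omega>))) = k" for \<omega>
      unfolding S_def mem_Collect_eq n prod.case ..
    show "{\<omega> \<in> space M. n \<in> S \<omega>} \<in> sets M"
    proof (cases "j \<in> {1..J}")
      case True
      note [measurable] = batch_measurable[OF True]
      have [measurable]: "(\<lambda>\<omega>. X i j l \<omega> (max 0 (t - real_of_ereal (T i \<omega>)))) \<in> measurable M (count_space UNIV)"
        by (rule X_measurable_position[OF _ _ True]) measurable
      have "{\<omega> \<in> space M. l < Sig i j \<omega>} \<in> sets M" by measurable
      moreover have "{\<omega> \<in> space M. T i \<omega> \<le> ereal t} \<in> sets M" by measurable
      moreover have "{\<omega> \<in> space M. X i j l \<omega> (max 0 (t - real_of_ereal (T i \<omega>))) = k} \<in> sets M" by measurable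
      ultimately have "{\<omega> \<in> space M. l < Sig i j \<omega> \<and> T i \<omega> \<le> ereal t \<and>
          X i j l \<omega> (max 0 (t - real_of_ereal (T i \<omega>))) = k} \<in> sets M"
        by (intro sets.sets_Collect_conj)
      then show ?thesis unfolding n_iff using True by (simp only: simp_thms)
    next
      case False
      then show ?thesis unfolding n_iff by (simp only: simp_thms Collect_empty_eq) simp
    qed
  qed
  ultimately show ?thesis
    by (rule measurable_cong[THEN iffD2])
qed

text \<open>
  The independent sources take values in different spaces. To place them in one product, each source is
  replaced by the identity map from \<open>M\<close> to \<open>M\<close> with the sigma-algebra of that source. The joint law of
  these maps is a product measure, and a function of \<open>\<omega>\<close> in which each occurrence of \<open>\<omega>\<close> is measurable for one
  source can be integrated one source at a time.
\<close>

lemma nn_integral_sources: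
  assumes U: "U \<subseteq> sources" "U \<noteq> {}"
    and F: "F \<in> borel_measurable (PiM U salg)"
  shows "(\<integral>\<^sup>+\<omega>. F (\<lambda>u\<in>U. \<omega>) \<partial>M) = (\<integral>\<^sup>+x. F x \<partial>PiM U (\<lambda>u. distr M (salg u) (\<lambda>\<omega>. \<omega>)))"
proof -
  have rv: "(\<lambda>\<omega>. \<omega>) \<in> measurable M (salg u)" if "u \<in> U" for u
    using ident_measurable_salg U that by auto
  have "{(\<lambda>\<omega>. \<omega>) -` A \<inter> space M | A. A \<in> sets (salg u)} = sets (salg u)" for u
  proof -
    have *: "(\<lambda>\<omega>. \<omega>) -` A \<inter> space M = A" if "A \<in> sets (salg u)" for A
      using sets.sets_into_space[OF that] by (auto simp: space_salg)
    show ?thesis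
    proof safe
      fix A assume A: "A \<in> sets (salg u)"
      show "(\<lambda>\<omega>. \<omega>) -` A \<inter> space M \<in> sets (salg u)" using A by (simp only: *)
      show "\<exists>B. A = (\<lambda>\<omega>. \<omega>) -` B \<inter> space M \<and> B \<in> sets (salg u)"
        using A by (intro exI[of _ A] conjI) (simp_all only: *)
    qed
  qed
  then have "indep_vars salg (\<lambda>u \<omega>. \<omega>) U"
    unfolding indep_vars_def2 using rv indep_sets_mono_index[OF U(1) independent]
    by (intro conjI ballI) (simp_all only:)
  then have law: "distr M (PiM U salg) (\<lambda>\<omega>. \<lambda>u\<in>U. \<omega>) = PiM U (\<lambda>u. distr M (salg u) (\<lambda>\<omega>. \<omega>))"
    using indep_vars_iff_distr_eq_PiM'[OF U(2), where M' = salg and X = "\<lambda>u \<omega>. \<omega>"] rv by blast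
  have "(\<lambda>\<omega>. \<lambda>u\<in>U. \<omega>) \<in> measurable M (PiM U salg)"
    using rv by (intro measurable_restrict) auto
  then have "(\<integral>\<^sup>+x. F x \<partial>distr M (PiM U salg) (\<lambda>\<omega>. \<lambda>u\<in>U. \<omega>)) = (\<integral>\<^sup>+\<omega>. F (\<lambda>u\<in>U. \<omega>) \<partial>M)"
    by (rule nn_integral_distr) (simp add: F)
  then show ?thesis
    unfolding law ..
qed

end

lemma (in product_sigma_finite) nn_integral_prod_reindexed:
  assumes fin: "finite A" and inj: "inj_on e A"
    and f: "\<And>a. a \<in> A \<Longrightarrow> f a \<in> borel_measurable (M (e a))"
  shows "(\<integral>\<^sup>+x. (\<Prod>a\<in>A. f a (x (e a))) \<partial>PiM (e ` A) M) = (\<Prod>a\<in>A. \<integral>\<^sup>+y. f a y \<partial>M (e a))"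
proof -
  define f' where "f' = (\<lambda>u. f (the_inv_into A e u))"
  have f': "f' (e a) = f a" if "a \<in> A" for a
    unfolding f'_def using the_inv_into_f_f[OF inj that] by simp
  have "(\<integral>\<^sup>+x. (\<Prod>a\<in>A. f a (x (e a))) \<partial>PiM (e ` A) M) = (\<integral>\<^sup>+x. (\<Prod>u\<in>e ` A. f' u (x u)) \<partial>PiM (e ` A) M)"
    by (simp add: prod.reindex[OF inj] f')
  also have "\<dots> = (\<Prod>u\<in>e ` A. \<integral>\<^sup>+y. f' u y \<partial>M u)"
    by (rule product_nn_integral_prod) (use fin f f' in auto)
  also have "\<dots> = (\<Prod>a\<in>A. \<integral>\<^sup>+y. f a y \<partial>M (e a))"
    by (simp add: prod.reindex[OF inj] f')
  finally show ?thesis .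
qed

context batch_network
begin

text \<open>
  Only the first \<open>m\<close> batches and the first \<open>m\<close> customers of each are used, so that finitely many sources
  are involved. Fubini's theorem averages first over the routes, then over the batch sizes, with the arrival times held
  fixed; within each of the first two groups the integrand is a product of functions of distinct sources.
\<close>

lemma nn_integral_truncated_product:
  fixes g :: "ereal \<Rightarrow> (real \<Rightarrow> nat) \<Rightarrow> ennreal"
  assumes g: "(\<lambda>(\<tau>, x). g \<tau> x) \<in> borel_measurable (borel \<Otimes>\<^sub>M D)"
  defines "c \<equiv> (\<lambda>i j l \<tau>. \<integral>\<^sup>+\<omega>. g \<tau> (X i j l \<omega>) \<partial>M)"
  shows "(\<integral>\<^sup>+\<omega>. (\<Prod>i<m. \<Prod>j=1..J. \<Prod>l<m. if l < Sig i j \<omega> then g (T i \<omega>) (X i j l \<omega>) else 1) \<partial>M)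
    = (\<integral>\<^sup>+\<omega>. (\<Prod>i<m. \<integral>\<^sup>+\<omega>'. (\<Prod>j=1..J. \<Prod>l<m. if l < Sig i j \<omega>' then c i j l (T i \<omega>) else 1) \<partial>M) \<partial>M)"
proof -
  \<comment> \<open>the default \<open>M\<close> only makes every \<open>Q u\<close> a probability space\<close>
  define Q where "Q = (\<lambda>u. if u \<in> sources then distr M (salg u) (\<lambda>\<omega>. \<omega>) else M)"
  have Q_prob: "prob_space (Q u)" for u
    unfolding Q_def using prob_space_distr[OF ident_measurable_salg] prob_space_axioms by auto
  interpret Q: product_sigma_finite Q
    by (intro product_sigma_finite.intro prob_space_imp_sigma_finite Q_prob)
  have Q_sets: "sets (Q u) = sets (salg u)" if "u \<in> sources" for u
    using that by (simp add: Q_def)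
  have Q_measurable: "f \<in> measurable (Q u) N" if "u \<in> sources" "f \<in> measurable (salg u) N" for u f and N :: "'z measure"
    using that measurable_cong_sets[OF Q_sets[OF that(1)] refl] by blast
  have Q_nn_integral: "(\<integral>\<^sup>+y. f y \<partial>Q u) = (\<integral>\<^sup>+\<omega>. f \<omega> \<partial>M)"
    if "u \<in> sources" "f \<in> borel_measurable (salg u)" for u f
    using nn_integral_distr[OF ident_measurable_salg[OF that(1)], of f] that by (simp add: Q_def)

  define Rs where "Rs = (\<lambda>(i, j, l). Route i j l) ` ({..<m} \<times> {1..J} \<times> {..<m})"
  define Bs where "Bs = Batch ` {..<m}"
  define U where "U = insert Arrivals (Bs \<union> Rs)"
  have fin: "finite Bs" "finite Rs" and disj: "Bs \<inter> Rs = {}" "Arrivals \<notin> Bs \<union> Rs"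
    and U_sub: "U \<subseteq> sources"
    by (auto simp: Bs_def Rs_def U_def)
  have Rs_mem: "Route i j l \<in> Rs" if "i < m" "j \<in> {1..J}" "l < m" for i j l
    using that unfolding Rs_def by force
  have Bs_mem: "Batch i \<in> Bs" if "i < m" for i
    using that by (auto simp: Bs_def)
  \<comment> \<open>in \<open>F a x\<close> the sample point for the arrival times is separated from those for the batches and routes\<close>
  define F where "F = (\<lambda>a x. \<Prod>i<m. \<Prod>j=1..J. \<Prod>l<m.
    if l < Sig i j (x (Batch i)) then g (T i a) (X i j l (x (Route i j l))) else 1)"

  have Sig_comp: "(\<lambda>x. Sig i j (x (Batch i))) \<in> measurable (PiM V Q) (count_space UNIV)"
    if "Batch i \<in> V" "j \<in> {1..J}" for i j V
  proof -
    have "Sig i j \<in> measurable (Q (Batch i)) (count_space UNIV)"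
      by (rule Q_measurable[OF _ Sig_measurable_salg[OF that(2)]]) auto
    then show ?thesis
      by (rule measurable_compose[OF measurable_component_singleton[OF that(1)]])
  qed
  have X_comp: "(\<lambda>x. X i j l (x (Route i j l))) \<in> measurable (PiM V Q) D"
    if "Route i j l \<in> V" "j \<in> {1..J}" for i j l V
  proof -
    have "X i j l \<in> measurable (Q (Route i j l)) D"
      by (rule Q_measurable[OF _ X_measurable_salg[OF that(2)]]) (use that in auto)
    then show ?thesis
      by (rule measurable_compose[OF measurable_component_singleton[OF that(1)]])
  qed
  have T_comp: "(\<lambda>x. T i (x Arrivals)) \<in> borel_measurable (PiM V Q)" if "Arrivals \<in> V" for i V
  proof -
    have "T i \<in> borel_measurable (Q Arrivals)"
      by (rule Q_measurable[OF _ T_measurable_salg]) auto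
    then show ?thesis
      by (rule measurable_compose[OF measurable_component_singleton[OF that]])
  qed
  have F_measurable: "(\<lambda>x. F (a x) x) \<in> borel_measurable (PiM V Q)"
    if a: "\<And>i. (\<lambda>x. T i (a x)) \<in> borel_measurable (PiM V Q)" and V: "Bs \<union> Rs \<subseteq> V" for a V
    unfolding F_def
  proof (intro borel_measurable_prod_ennreal measurable_If)
    fix i j l assume ijl: "i \<in> {..<m}" "j \<in> {1..J}" "l \<in> {..<m}"
    have mem: "Route i j l \<in> V" "Batch i \<in> V"
      using V Rs_mem[of i j l] Bs_mem[of i] ijl by auto
    have "(\<lambda>x. (T i (a x), X i j l (x (Route i j l)))) \<in> measurable (PiM V Q) (borel \<Otimes>\<^sub>M D)"
      by (intro measurable_Pair a X_comp mem ijl)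
    from measurable_compose[OF this g]
    show "(\<lambda>x. g (T i (a x)) (X i j l (x (Route i j l)))) \<in> borel_measurable (PiM V Q)"
      by simp
    have [measurable]: "(\<lambda>x. Sig i j (x (Batch i))) \<in> measurable (PiM V Q) (count_space UNIV)"
      by (rule Sig_comp) fact+
    show "{x \<in> space (PiM V Q). l < Sig i j (x (Batch i))} \<in> sets (PiM V Q)"
      by measurable
  qed simp

  have gX_measurable: "(\<lambda>y. g \<tau> (X i j l y)) \<in> borel_measurable (salg (Route i j l))"
    if "j \<in> {1..J}" for \<tau> i j l
    using measurable_compose[OF measurable_Pair[OF measurable_const X_measurable_salg[OF that]] g, of \<tau>]
    by simp

  have routes: "(\<integral>\<^sup>+r. (\<Prod>i<m. \<Prod>j=1..J. \<Prod>l<m.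
        if l < Sig i j (b (Batch i)) then g (T i a) (X i j l (r (Route i j l))) else 1) \<partial>PiM Rs Q)
      = (\<Prod>i<m. \<Prod>j=1..J. \<Prod>l<m. if l < Sig i j (b (Batch i)) then c i j l (T i a) else 1)" for a b
  proof -
    let ?f = "\<lambda>(i, j, l) y. if l < Sig i j (b (Batch i)) then g (T i a) (X i j l y) else (1::ennreal)"
    let ?e = "\<lambda>(i, j, l). Route i j l"
    let ?V = "{..<m} \<times> {1..J} \<times> {..<m}"
    have "(\<integral>\<^sup>+r. (\<Prod>i<m. \<Prod>j=1..J. \<Prod>l<m.
        if l < Sig i j (b (Batch i)) then g (T i a) (X i j l (r (Route i j l))) else 1) \<partial>PiM Rs Q)
      = (\<integral>\<^sup>+r. (\<Prod>v\<in>?V. ?f v (r (?e v))) \<partial>PiM (?e ` ?V) Q)"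
      unfolding Rs_def by (simp add: prod.cartesian_product case_prod_unfold)
    also have "\<dots> = (\<Prod>v\<in>?V. \<integral>\<^sup>+y. ?f v y \<partial>Q (?e v))"
    proof (rule Q.nn_integral_prod_reindexed)
      show "?f v \<in> borel_measurable (Q (?e v))" if "v \<in> ?V" for v
      proof -
        obtain i j l where v: "v = (i, j, l)" "j \<in> {1..J}" using \<open>v \<in> ?V\<close> by auto
        have "?f v \<in> borel_measurable (salg (?e v))"
          using gX_measurable[OF v(2)] by (simp add: v)
        then show ?thesis
          by (rule Q_measurable[rotated]) (use v in auto)
      qed
    qed (auto simp: inj_on_def)
    also have "\<dots> = (\<Prod>v\<in>?V. (\<lambda>(i, j, l). if l < Sig i j (b (Batch i)) then c i j l (T i a) else 1) v)"
    proof (rule prod.cong[OF refl])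
      fix v assume "v \<in> ?V"
      then obtain i j l where v: "v = (i, j, l)" "j \<in> {1..J}" by auto
      show "(\<integral>\<^sup>+y. ?f v y \<partial>Q (?e v)) = (\<lambda>(i, j, l). if l < Sig i j (b (Batch i)) then c i j l (T i a) else 1) v"
        using Q_nn_integral[OF _ gX_measurable[OF v(2)]] v prob_space.emeasure_space_1[OF Q_prob]
        by (auto simp: c_def)
    qed
    also have "\<dots> = (\<Prod>i<m. \<Prod>j=1..J. \<Prod>l<m. if l < Sig i j (b (Batch i)) then c i j l (T i a) else 1)"
      by (simp add: prod.cartesian_product case_prod_unfold)
    finally show ?thesis .
  qed

  define H where "H = (\<lambda>i \<tau> \<omega>'. \<Prod>j=1..J. \<Prod>l<m. if l < Sig i j \<omega>' then c i j l \<tau> else 1)"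
  have H_measurable: "H i \<tau> \<in> borel_measurable (salg (Batch i))" for i \<tau>
    unfolding H_def
  proof (intro borel_measurable_prod_ennreal measurable_If)
    fix j l assume "j \<in> {1..J}"
    note [measurable] = Sig_measurable_salg[OF this, of i]
    show "{x \<in> space (salg (Batch i)). l < Sig i j x} \<in> sets (salg (Batch i))"
      by measurable
  qed auto
  have batches: "(\<integral>\<^sup>+x. F a x \<partial>PiM (Bs \<union> Rs) Q) = (\<Prod>i<m. \<integral>\<^sup>+\<omega>'. H i (T i a) \<omega>' \<partial>M)" for a
  proof -
    have "(\<integral>\<^sup>+x. F a x \<partial>PiM (Bs \<union> Rs) Q)
        = (\<integral>\<^sup>+b. (\<integral>\<^sup>+r. F a (merge Bs Rs (b, r)) \<partial>PiM Rs Q) \<partial>PiM Bs Q)"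
      by (rule Q.product_nn_integral_fold[OF disj(1) fin])
         (rule F_measurable[of "\<lambda>_. a"], auto)
    also have "\<dots> = (\<integral>\<^sup>+b. (\<Prod>i<m. H i (T i a) (b (Batch i))) \<partial>PiM (Batch ` {..<m}) Q)"
    proof -
      have "F a (merge Bs Rs (b, r)) = (\<Prod>i<m. \<Prod>j=1..J. \<Prod>l<m.
        if l < Sig i j (b (Batch i)) then g (T i a) (X i j l (r (Route i j l))) else 1)" for b r
        unfolding F_def using Bs_mem Rs_mem disj
        by (intro prod.cong refl) (auto simp: merge_def)
      then show ?thesis
        unfolding routes H_def[symmetric] Bs_def[symmetric] by (simp only: routes H_def)
    qed
    also have "\<dots> = (\<Prod>i<m. \<integral>\<^sup>+y. H i (T i a) y \<partial>Q (Batch i))"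
    proof (rule Q.nn_integral_prod_reindexed)
      show "H i (T i a) \<in> borel_measurable (Q (Batch i))" for i
        by (rule Q_measurable[OF _ H_measurable]) auto
    qed (auto simp: inj_on_def)
    also have "\<dots> = (\<Prod>i<m. \<integral>\<^sup>+\<omega>'. H i (T i a) \<omega>' \<partial>M)"
      by (intro prod.cong refl Q_nn_integral H_measurable) auto
    finally show ?thesis .
  qed

  have c_measurable: "c i j l \<in> borel_measurable borel" if "j \<in> {1..J}" for i j l
  proof -
    have "(\<lambda>(\<tau>, \<omega>). (\<tau>, X i j l \<omega>)) \<in> measurable (borel \<Otimes>\<^sub>M M) (borel \<Otimes>\<^sub>M D)"
      using route_measurable[OF that] by measurable
    from measurable_compose[OF this g] show ?thesis
      unfolding c_def by (intro borel_measurable_nn_integral) (simp add: case_prod_unfold)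
  qed
  have "(\<integral>\<^sup>+\<omega>. (\<Prod>i<m. \<Prod>j=1..J. \<Prod>l<m. if l < Sig i j \<omega> then g (T i \<omega>) (X i j l \<omega>) else 1) \<partial>M)
      = (\<integral>\<^sup>+\<omega>. (\<lambda>x. F (x Arrivals) x) (\<lambda>u\<in>U. \<omega>) \<partial>M)"
    unfolding F_def using Bs_mem Rs_mem
    by (intro nn_integral_cong prod.cong refl) (auto simp: U_def)
  also have "\<dots> = (\<integral>\<^sup>+x. F (x Arrivals) x \<partial>PiM U (\<lambda>u. distr M (salg u) (\<lambda>\<omega>. \<omega>)))"
  proof (rule nn_integral_sources[OF U_sub])
    have "sets (PiM U Q) = sets (PiM U salg)"
      by (rule sets_PiM_cong) (use U_sub Q_sets in auto)
    moreover have "(\<lambda>x. F (x Arrivals) x) \<in> borel_measurable (PiM U Q)"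
      by (rule F_measurable[OF T_comp]) (auto simp: U_def)
    ultimately show "(\<lambda>x. F (x Arrivals) x) \<in> borel_measurable (PiM U salg)"
      by (simp cong: measurable_cong_sets)
  qed (simp add: U_def)
  also have "PiM U (\<lambda>u. distr M (salg u) (\<lambda>\<omega>. \<omega>)) = PiM (insert Arrivals (Bs \<union> Rs)) Q"
    unfolding U_def by (rule PiM_cong) (use U_sub in \<open>auto simp: Q_def U_def\<close>)
  also have "(\<integral>\<^sup>+x. F (x Arrivals) x \<partial>\<dots>) =
      (\<integral>\<^sup>+a. (\<integral>\<^sup>+x. F ((x(Arrivals := a)) Arrivals) (x(Arrivals := a)) \<partial>PiM (Bs \<union> Rs) Q) \<partial>Q Arrivals)"
    by (rule Q.product_nn_integral_insert_rev)
       (use fin disj in \<open>auto intro!: F_measurable T_comp\<close>)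
  also have "\<dots> = (\<integral>\<^sup>+a. (\<Prod>i<m. \<integral>\<^sup>+\<omega>'. H i (T i a) \<omega>' \<partial>M) \<partial>Q Arrivals)"
    unfolding batches[symmetric] by (simp add: F_def cong: if_cong)
  also have "\<dots> = (\<integral>\<^sup>+a. (\<Prod>i<m. \<integral>\<^sup>+\<omega>'. H i (T i a) \<omega>' \<partial>M) \<partial>M)"
  proof (rule Q_nn_integral)
    have "(\<lambda>\<tau>. \<integral>\<^sup>+\<omega>'. H i \<tau> \<omega>' \<partial>M) \<in> borel_measurable borel" for i
    proof (rule borel_measurable_nn_integral, unfold H_def case_prod_unfold,
        intro borel_measurable_prod_ennreal measurable_If)
      fix j l assume j: "j \<in> {1..J}"
      note [measurable] = c_measurable[OF j] batch_measurable[OF j]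
      show "(\<lambda>x. c i j l (fst x)) \<in> borel_measurable (borel \<Otimes>\<^sub>M M)" by measurable
      show "{x \<in> space (borel \<Otimes>\<^sub>M M). l < Sig i j (snd x)} \<in> sets (borel \<Otimes>\<^sub>M M)" by measurable
    qed simp
    from measurable_compose[OF T_measurable_salg this]
    show "(\<lambda>a. \<Prod>i<m. \<integral>\<^sup>+\<omega>'. H i (T i a) \<omega>' \<partial>M) \<in> borel_measurable (salg Arrivals)"
      by (intro borel_measurable_prod_ennreal) auto
  qed simp
  finally show ?thesis
    unfolding H_def .
qed

end

context batch_network
begin

text \<open>
  The mean of the factor that a customer entering queue \<open>j\<close> at time \<open>\<tau>\<close> contributes to \<open>\<Prod>k. z k ^ N\<^sub>k\<close>. Points after
  time \<open>t\<close> get the value 1, so that products over all points of the process make sense.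
\<close>

definition customer_pgf :: "(nat \<Rightarrow> real) \<Rightarrow> real \<Rightarrow> nat \<Rightarrow> ereal \<Rightarrow> real" where
  "customer_pgf z t j \<tau> = (if \<tau> \<le> ereal t
     then 1 - (\<Sum>k=1..J. (1 - z k) * qe j k (max 0 (t - real_of_ereal \<tau>))) else 1)"

definition customer_weight :: "(nat \<Rightarrow> real) \<Rightarrow> real \<Rightarrow> ereal \<Rightarrow> (real \<Rightarrow> nat) \<Rightarrow> real" where
  "customer_weight z t \<tau> x = (if \<tau> \<le> ereal t
     then position_weight J z (x (max 0 (t - real_of_ereal \<tau>))) else 1)"

lemma customer_weight_range:
  "(\<And>k. k \<in> {1..J} \<Longrightarrow> z k \<in> {0..1}) \<Longrightarrow> customer_weight z t \<tau> x \<in> {0..1}"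
  using position_weight_range[of J z] by (simp add: customer_weight_def)

lemma customer_weight_measurable:
  "(\<lambda>(\<tau>, x). customer_weight z t \<tau> x) \<in> borel_measurable (borel \<Otimes>\<^sub>M D)"
proof -
  have "(\<lambda>(\<tau>, x). (t - real_of_ereal \<tau>, x)) \<in> measurable (borel \<Otimes>\<^sub>M D) (borel \<Otimes>\<^sub>M D)"
    by measurable
  from measurable_compose[OF this position_measurable]
  have [measurable]: "(\<lambda>p. snd p (max 0 (t - real_of_ereal (fst p)))) \<in> measurable (borel \<Otimes>\<^sub>M D) (count_space UNIV)"
    by (simp add: case_prod_unfold)
  have [measurable]: "position_weight J z \<in> borel_measurable (count_space UNIV)"
    by simp
  show ?thesis
    unfolding customer_weight_def case_prod_unfold by measurable
qed

lemma customer_weight_measurable_M: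
  assumes "j \<in> {1..J}"
  shows "(\<lambda>\<omega>. customer_weight z t (T i \<omega>) (X i j l \<omega>)) \<in> borel_measurable M"
    and "(\<lambda>\<omega>. customer_weight z t \<tau> (X i j l \<omega>)) \<in> borel_measurable M"
proof -
  note [measurable] = route_measurable[OF assms]
  have "(\<lambda>\<omega>. (T i \<omega>, X i j l \<omega>)) \<in> measurable M (borel \<Otimes>\<^sub>M D)" by measurable
  from measurable_compose[OF this customer_weight_measurable]
  show "(\<lambda>\<omega>. customer_weight z t (T i \<omega>) (X i j l \<omega>)) \<in> borel_measurable M" by simp
  have "(\<lambda>\<omega>. (\<tau>, X i j l \<omega>)) \<in> measurable M (borel \<Otimes>\<^sub>M D)" by measurable
  from measurable_compose[OF this customer_weight_measurable]
  show "(\<lambda>\<omega>. customer_weight z t \<tau> (X i j l \<omega>)) \<in> borel_measurable M" by simp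
qed

lemma expectation_customer_weight:
  assumes j: "j \<in> {1..J}"
  shows "expectation (\<lambda>\<omega>. customer_weight z t \<tau> (X i j l \<omega>)) = customer_pgf z t j \<tau>"
proof (cases "\<tau> \<le> ereal t")
  case True
  define s where "s = max 0 (t - real_of_ereal \<tau>)"
  have X_meas: "(\<lambda>\<omega>. X i j l \<omega> s) \<in> measurable M (count_space UNIV)"
    using X_measurable_position[OF measurable_const measurable_ident_sets[OF refl] j, of s i l]
    by (simp add: s_def)
  define f where "f = (\<lambda>k \<omega>. (1 - z k) * indicator {\<omega> \<in> space M. X i j l \<omega> s = k} \<omega>)"
  have f: "integrable M (f k)" "expectation (f k) = (1 - z k) * qe j k s" if "k \<in> {1..J}" for k
  proof -
    have A: "{\<omega> \<in> space M. X i j l \<omega> s = k} \<in> events" using X_meas by measurable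
    then have "integrable M (indicator {\<omega> \<in> space M. X i j l \<omega> s = k} :: 'a \<Rightarrow> real)"
      by (intro integrable_real_indicator) (auto simp: emeasure_eq_measure)
    then show "integrable M (f k)"
      unfolding f_def by (rule integrable_mult_right)
    show "expectation (f k) = (1 - z k) * qe j k s"
      unfolding f_def using route_law[OF j that, of s i l] A by (simp add: s_def)
  qed
  have "expectation (\<lambda>\<omega>. customer_weight z t \<tau> (X i j l \<omega>)) = expectation (\<lambda>\<omega>. 1 - (\<Sum>k=1..J. f k \<omega>))"
    using True
    by (intro Bochner_Integration.integral_cong refl)
       (auto simp: customer_weight_def position_weight_eq_sum s_def f_def indicator_def intro!: sum.cong)
  also have "\<dots> = 1 - (\<Sum>k=1..J. (1 - z k) * qe j k s)"
  proof -
    have "integrable M (\<lambda>\<omega>. \<Sum>k=1..J. f k \<omega>)"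
      by (rule Bochner_Integration.integrable_sum) (rule f)
    moreover have "expectation (\<lambda>\<omega>. \<Sum>k=1..J. f k \<omega>) = (\<Sum>k=1..J. (1 - z k) * qe j k s)"
      by (subst Bochner_Integration.integral_sum) (rule f, assumption, rule sum.cong, simp_all add: f)
    ultimately show ?thesis
      by (simp add: prob_space)
  qed
  finally show ?thesis
    using True by (simp add: customer_pgf_def s_def)
qed (simp add: customer_weight_def customer_pgf_def prob_space)

lemma customer_pgf_range:
  assumes "j \<in> {1..J}" and z: "\<And>k. k \<in> {1..J} \<Longrightarrow> z k \<in> {0..1}"
  shows "customer_pgf z t j \<tau> \<in> {0..1}"
proof -
  have "integrable M (\<lambda>\<omega>. customer_weight z t \<tau> (X 0 j 0 \<omega>))"
    by (rule integrable_const_bound[where B = 1])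
       (use customer_weight_measurable_M[OF assms(1)] customer_weight_range[OF z] in auto)
  then have "expectation (\<lambda>\<omega>. customer_weight z t \<tau> (X 0 j 0 \<omega>)) \<in> {0..1}"
    using customer_weight_range[OF z] by (auto intro!: integral_nonneg_AE integral_le_const)
  then show ?thesis
    by (simp only: expectation_customer_weight[OF assms(1)])
qed

text \<open>
  Measurability in time of the occupation probabilities follows from joint measurability of path evaluation
  by Fubini's theorem; the route used is an arbitrary one with the right law.
\<close>

lemma qe_measurable:
  assumes j: "j \<in> {1..J}" and k: "k \<in> {1..J}"
  shows "(\<lambda>s. qe j k (max 0 s)) \<in> borel_measurable borel"
proof -
  have pos: "(\<lambda>p. X 0 j 0 (snd p) (max 0 (fst p))) \<in> measurable (borel \<Otimes>\<^sub>M M) (count_space UNIV)"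
    by (rule X_measurable_position[OF _ _ j]) auto
  have "(\<lambda>s. expectation (\<lambda>\<omega>. indicat_real {k} (X 0 j 0 \<omega> (max 0 s)))) \<in> borel_measurable borel"
  proof (rule borel_measurable_lebesgue_integral)
    have "(\<lambda>p. indicat_real {k} (X 0 j 0 (snd p) (max 0 (fst p)))) \<in> borel_measurable (borel \<Otimes>\<^sub>M M)"
      by (rule measurable_compose[OF pos]) simp
    then show "(\<lambda>(s, \<omega>). indicat_real {k} (X 0 j 0 \<omega> (max 0 s))) \<in> borel_measurable (borel \<Otimes>\<^sub>M M)"
      by (simp add: case_prod_unfold)
  qed
  also have "(\<lambda>s. expectation (\<lambda>\<omega>. indicat_real {k} (X 0 j 0 \<omega> (max 0 s)))) = (\<lambda>s. qe j k (max 0 s))"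
  proof
    fix s
    have "expectation (\<lambda>\<omega>. indicat_real {k} (X 0 j 0 \<omega> (max 0 s)))
        = expectation (indicat_real {\<omega> \<in> space M. X 0 j 0 \<omega> (max 0 s) = k})"
      by (intro Bochner_Integration.integral_cong refl) (auto simp: indicator_def)
    also have "\<dots> = qe j k (max 0 s)"
      using route_law[OF j k, of "max 0 s" 0 0] by (simp add: Int_def conj_commute)
    finally show "expectation (\<lambda>\<omega>. indicat_real {k} (X 0 j 0 \<omega> (max 0 s))) = qe j k (max 0 s)" .
  qed
  finally show ?thesis .
qed

lemma qe_nonneg: "\<lbrakk>j \<in> {1..J}; k \<in> {1..J}; 0 \<le> s\<rbrakk> \<Longrightarrow> 0 \<le> qe j k s"
  using route_law[of j k s 0 0] by (metis measure_nonneg)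

lemma customer_pgf_measurable[measurable]:
  assumes "j \<in> {1..J}"
  shows "customer_pgf z t j \<in> borel_measurable borel"
proof -
  have [measurable]: "(\<lambda>\<tau>. qe j k (max 0 (t - real_of_ereal \<tau>))) \<in> borel_measurable borel" if "k \<in> {1..J}" for k
    by (rule measurable_compose[OF _ qe_measurable[OF assms that]]) measurable
  show ?thesis
    unfolding customer_pgf_def by measurable
qed

text \<open>
  The generating function restricted to finitely many batches and customers, so that it depends on finitely many
  independent sources. The next definition is the mean factor of batch \<open>i\<close>, arriving at time \<open>\<tau>\<close>, given its entry numbers \<open>Sig i j\<close>.
\<close>

definition truncated_weight :: "(nat \<Rightarrow> real) \<Rightarrow> real \<Rightarrow> nat \<Rightarrow> 'a \<Rightarrow> real" where
  "truncated_weight z t m \<omega> = (\<Prod>i<m. \<Prod>j=1..J. \<Prod>l<m.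
     if l < Sig i j \<omega> then customer_weight z t (T i \<omega>) (X i j l \<omega>) else 1)"

definition truncated_batch :: "(nat \<Rightarrow> real) \<Rightarrow> real \<Rightarrow> nat \<Rightarrow> nat \<Rightarrow> ereal \<Rightarrow> 'a \<Rightarrow> real" where
  "truncated_batch z t m i \<tau> \<omega> = (\<Prod>j=1..J. \<Prod>l<m. if l < Sig i j \<omega> then customer_pgf z t j \<tau> else 1)"

lemma truncated_weight_measurable[measurable]: "truncated_weight z t m \<in> borel_measurable M"
  unfolding truncated_weight_def
proof (intro borel_measurable_prod measurable_If)
  fix i j l assume j: "j \<in> {1..J}"
  note [measurable] = batch_measurable[OF j]
  show "(\<lambda>\<omega>. customer_weight z t (T i \<omega>) (X i j l \<omega>)) \<in> borel_measurable M"
    by (rule customer_weight_measurable_M[OF j])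
  show "{x \<in> space M. l < Sig i j x} \<in> sets M" by measurable
qed simp

lemma truncated_batch_measurable:
  "(\<lambda>(\<tau>, \<omega>). truncated_batch z t m i \<tau> \<omega>) \<in> borel_measurable (borel \<Otimes>\<^sub>M M)"
  unfolding truncated_batch_def case_prod_unfold
proof (intro borel_measurable_prod measurable_If)
  fix j l assume j: "j \<in> {1..J}"
  note [measurable] = customer_pgf_measurable[OF j] batch_measurable[OF j]
  show "(\<lambda>x. customer_pgf z t j (fst x)) \<in> borel_measurable (borel \<Otimes>\<^sub>M M)" by measurable
  show "{x \<in> space (borel \<Otimes>\<^sub>M M). l < Sig i j (snd x)} \<in> sets (borel \<Otimes>\<^sub>M M)" by measurable
qed simp

lemma expectation_truncated_batch_measurable[measurable]:
  "(\<lambda>\<tau>. expectation (truncated_batch z t m i \<tau>)) \<in> borel_measurable borel"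
  by (rule borel_measurable_lebesgue_integral[OF truncated_batch_measurable])

lemma
  assumes z: "\<And>k. k \<in> {1..J} \<Longrightarrow> z k \<in> {0..1}"
  shows truncated_weight_range: "0 \<le> truncated_weight z t m \<omega>" "truncated_weight z t m \<omega> \<le> 1"
    and integrable_truncated_weight: "integrable M (truncated_weight z t m)"
    and truncated_batch_range: "0 \<le> truncated_batch z t m i \<tau> \<omega>" "truncated_batch z t m i \<tau> \<omega> \<le> 1"
    and integrable_truncated_batch: "integrable M (truncated_batch z t m i \<tau>)"
    and expectation_truncated_batch_range:
      "0 \<le> expectation (truncated_batch z t m i \<tau>)" "expectation (truncated_batch z t m i \<tau>) \<le> 1"
proof -
  note range = customer_weight_range[OF z, simplified] customer_pgf_range[OF _ z, simplified]
  show w: "0 \<le> truncated_weight z t m \<omega>" "truncated_weight z t m \<omega> \<le> 1" for \<omega>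
    unfolding truncated_weight_def using range(1) by (auto intro!: prod_nonneg prod_le_1)
  show "integrable M (truncated_weight z t m)"
    by (rule integrable_const_bound[where B = 1]) (use w in auto)
  show b: "0 \<le> truncated_batch z t m i \<tau> \<omega>" "truncated_batch z t m i \<tau> \<omega> \<le> 1" for \<omega>
    unfolding truncated_batch_def using range(2) by (auto intro!: prod_nonneg prod_le_1)
  show int: "integrable M (truncated_batch z t m i \<tau>)"
    by (rule integrable_const_bound[where B = 1])
       (use b measurable_compose[OF measurable_Pair1' truncated_batch_measurable, of \<tau> z t m i] in auto)
  show "0 \<le> expectation (truncated_batch z t m i \<tau>)" "expectation (truncated_batch z t m i \<tau>) \<le> 1"
    using b int by (auto intro!: integral_nonneg_AE integral_le_const)
qed

text \<open>
  All factors lie in \<open>[0,1]\<close>, so the averaging done for nonnegative extended reals carries over to expectations.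
\<close>

lemma expectation_truncated_weight:
  assumes z: "\<And>k. k \<in> {1..J} \<Longrightarrow> z k \<in> {0..1}"
  shows "expectation (truncated_weight z t m)
    = expectation (\<lambda>\<omega>. \<Prod>i<m. expectation (truncated_batch z t m i (T i \<omega>)))"
proof -
  note range = customer_weight_range[OF z, simplified] customer_pgf_range[OF _ z, simplified]
  note b_range = expectation_truncated_batch_range[OF z]
  let ?Z = "\<lambda>\<omega>. \<Prod>i<m. expectation (truncated_batch z t m i (T i \<omega>))"
  have Z_range: "0 \<le> ?Z \<omega>" "?Z \<omega> \<le> 1" for \<omega>
    using b_range by (auto intro!: prod_nonneg prod_le_1)
  have Z_int: "integrable M ?Z"
    by (rule integrable_const_bound[where B = 1]) (use Z_range in auto)
  have if_ennreal: "(if b then ennreal x else 1) = ennreal (if b then x else 1)" for b x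
    by simp
  have g: "(\<lambda>(\<tau>, x). ennreal (customer_weight z t \<tau> x)) \<in> borel_measurable (borel \<Otimes>\<^sub>M D)"
    using customer_weight_measurable[of z t] by (simp add: case_prod_unfold)
  have c: "(\<integral>\<^sup>+\<omega>. ennreal (customer_weight z t \<tau> (X i j l \<omega>)) \<partial>M) = ennreal (customer_pgf z t j \<tau>)"
    if j: "j \<in> {1..J}" for i j l \<tau>
  proof -
    have "integrable M (\<lambda>\<omega>. customer_weight z t \<tau> (X i j l \<omega>))"
      by (rule integrable_const_bound[where B = 1])
         (use customer_weight_measurable_M[OF j] range in auto)
    then show ?thesis
      using range by (simp add: nn_integral_eq_integral expectation_customer_weight[OF j])
  qed
  have weight: "ennreal (truncated_weight z t m \<omega>) = (\<Prod>i<m. \<Prod>j=1..J. \<Prod>l<m.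
      if l < Sig i j \<omega> then ennreal (customer_weight z t (T i \<omega>) (X i j l \<omega>)) else 1)" for \<omega>
  proof -
    have "ennreal (truncated_weight z t m \<omega>) = (\<Prod>i<m. ennreal (\<Prod>j=1..J. \<Prod>l<m.
        if l < Sig i j \<omega> then customer_weight z t (T i \<omega>) (X i j l \<omega>) else 1))"
      unfolding truncated_weight_def using range(1) by (intro prod_ennreal[symmetric] prod_nonneg) auto
    also have "\<dots> = (\<Prod>i<m. \<Prod>j=1..J. ennreal (\<Prod>l<m.
        if l < Sig i j \<omega> then customer_weight z t (T i \<omega>) (X i j l \<omega>) else 1))"
      using range(1) by (intro prod.cong refl prod_ennreal[symmetric] prod_nonneg) auto
    also have "\<dots> = (\<Prod>i<m. \<Prod>j=1..J. \<Prod>l<m.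
        if l < Sig i j \<omega> then ennreal (customer_weight z t (T i \<omega>) (X i j l \<omega>)) else 1)"
      unfolding if_ennreal using range(1) by (intro prod.cong refl prod_ennreal[symmetric]) auto
    finally show ?thesis .
  qed
  have batch: "(\<integral>\<^sup>+\<omega>'. (\<Prod>j=1..J. \<Prod>l<m. if l < Sig i j \<omega>' then
      (\<integral>\<^sup>+\<omega>''. ennreal (customer_weight z t \<tau> (X i j l \<omega>'')) \<partial>M) else 1) \<partial>M)
      = ennreal (expectation (truncated_batch z t m i \<tau>))" for i \<tau>
  proof -
    have "(\<Prod>j=1..J. \<Prod>l<m. if l < Sig i j \<omega>' then (\<integral>\<^sup>+\<omega>''. ennreal (customer_weight z t \<tau> (X i j l \<omega>'')) \<partial>M) else 1)
        = ennreal (truncated_batch z t m i \<tau> \<omega>')" for \<omega>'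
    proof -
      have "(\<Prod>j=1..J. \<Prod>l<m. if l < Sig i j \<omega>' then (\<integral>\<^sup>+\<omega>''. ennreal (customer_weight z t \<tau> (X i j l \<omega>'')) \<partial>M) else 1)
          = (\<Prod>j=1..J. \<Prod>l<m. ennreal (if l < Sig i j \<omega>' then customer_pgf z t j \<tau> else 1))"
        by (intro prod.cong refl) (simp add: c)
      also have "\<dots> = (\<Prod>j=1..J. ennreal (\<Prod>l<m. if l < Sig i j \<omega>' then customer_pgf z t j \<tau> else 1))"
        using range(2) by (intro prod.cong refl prod_ennreal) auto
      also have "\<dots> = ennreal (truncated_batch z t m i \<tau> \<omega>')"
        unfolding truncated_batch_def using range(2) by (intro prod_ennreal prod_nonneg) auto
      finally show ?thesis .
    qed
    then show ?thesis
      using nn_integral_eq_integral[OF integrable_truncated_batch[OF z]] truncated_batch_range[OF z] by simp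
  qed
  have "ennreal (expectation (truncated_weight z t m)) = (\<integral>\<^sup>+\<omega>. ennreal (truncated_weight z t m \<omega>) \<partial>M)"
    using nn_integral_eq_integral[OF integrable_truncated_weight[OF z]] truncated_weight_range[OF z] by simp
  also have "\<dots> = (\<integral>\<^sup>+\<omega>. (\<Prod>i<m. \<integral>\<^sup>+\<omega>'. (\<Prod>j=1..J. \<Prod>l<m.
      if l < Sig i j \<omega>' then (\<integral>\<^sup>+\<omega>''. ennreal (customer_weight z t (T i \<omega>) (X i j l \<omega>'')) \<partial>M) else 1) \<partial>M) \<partial>M)"
    unfolding weight by (rule nn_integral_truncated_product[OF g])
  also have "\<dots> = (\<integral>\<^sup>+\<omega>. ennreal (?Z \<omega>) \<partial>M)"
    unfolding batch using b_range by (intro nn_integral_cong prod_ennreal) auto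
  also have "\<dots> = ennreal (expectation ?Z)"
    using Z_int Z_range by (simp add: nn_integral_eq_integral)
  finally show ?thesis
    using truncated_weight_range[OF z] Z_range by (subst (asm) ennreal_inj) (auto intro!: integral_nonneg_AE)
qed

text \<open>
  As the truncation is removed, the factor of a batch tends to \<open>\<Prod>j. c j ^ Sig i j\<close>, whose mean is the generating
  function of the batch vector.
\<close>

lemma tendsto_expectation_truncated_batch:
  assumes c: "\<And>j. j \<in> {1..J} \<Longrightarrow> c j \<in> {0..1}"
  shows "(\<lambda>m. expectation (\<lambda>\<omega>. \<Prod>j=1..J. \<Prod>l<m. if l < Sig i j \<omega> then c j else 1))
    \<longlonglongrightarrow> prob_gen_fun S (\<Sum>j=1..J. p j * c j)"
proof -
  have meas: "(\<lambda>\<omega>. \<Prod>j=1..J. \<Prod>l<m. if l < Sig i j \<omega> then c j else 1) \<in> borel_measurable M" for m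
  proof (intro borel_measurable_prod measurable_If)
    fix j l assume "j \<in> {1..J}"
    note [measurable] = batch_measurable[OF this]
    show "{x \<in> space M. l < Sig i j x} \<in> sets M" by measurable
  qed auto
  have meas': "(\<lambda>\<omega>. \<Prod>j=1..J. c j ^ Sig i j \<omega>) \<in> borel_measurable M"
  proof (intro borel_measurable_prod)
    fix j assume "j \<in> {1..J}"
    note [measurable] = batch_measurable[OF this]
    show "(\<lambda>\<omega>. c j ^ Sig i j \<omega>) \<in> borel_measurable M" by measurable
  qed
  have "(\<lambda>m. expectation (\<lambda>\<omega>. \<Prod>j=1..J. \<Prod>l<m. if l < Sig i j \<omega> then c j else 1))
      \<longlonglongrightarrow> expectation (\<lambda>\<omega>. \<Prod>j=1..J. c j ^ Sig i j \<omega>)"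
  proof (rule integral_dominated_convergence[where w = "\<lambda>_. 1"])
    show "AE \<omega> in M. (\<lambda>m. \<Prod>j=1..J. \<Prod>l<m. if l < Sig i j \<omega> then c j else 1)
        \<longlonglongrightarrow> (\<Prod>j=1..J. c j ^ Sig i j \<omega>)"
      using tendsto_prod_lessThan_truncated[of "{1..J}" "\<lambda>j. Sig i j _" "\<lambda>j l. c j"]
      by (intro AE_I2) simp
    show "AE \<omega> in M. norm (\<Prod>j=1..J. \<Prod>l<m. if l < Sig i j \<omega> then c j else 1) \<le> 1" for m
      using c by (intro AE_I2) (auto simp: abs_prod intro!: prod_le_1 prod_nonneg)
  qed (use meas meas' in auto)
  also have "expectation (\<lambda>\<omega>. \<Prod>j=1..J. c j ^ Sig i j \<omega>)
      = expectation (\<lambda>\<omega>. (\<lambda>x. \<Prod>j=1..J. c j ^ x j) (\<lambda>j\<in>{1..J}. Sig i j \<omega>))"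
    by (intro Bochner_Integration.integral_cong prod.cong refl) auto
  also have "\<dots> = (\<integral>x. (\<Prod>j=1..J. c j ^ x j) \<partial>BS)"
  proof -
    have "(\<lambda>\<omega>. \<lambda>j\<in>{1..J}. Sig i j \<omega>) \<in> measurable M (\<Pi>\<^sub>M j\<in>{1..J}. count_space UNIV)"
      by (intro measurable_restrict batch_measurable)
    then have "expectation (\<lambda>\<omega>. (\<lambda>x. \<Prod>j=1..J. c j ^ x j) (\<lambda>j\<in>{1..J}. Sig i j \<omega>))
      = (\<integral>x. (\<Prod>j=1..J. c j ^ x j) \<partial>distr M (\<Pi>\<^sub>M j\<in>{1..J}. count_space UNIV) (\<lambda>\<omega>. \<lambda>j\<in>{1..J}. Sig i j \<omega>))"
      by (subst integral_distr) auto
    then show ?thesis by (simp only: batch_law)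
  qed
  also have "\<dots> = prob_gen_fun S (\<Sum>j=1..J. p j * c j)"
    by (rule batch_pgf) (use c in auto)
  finally show ?thesis .
qed

definition batch_customer_pgf :: "(nat \<Rightarrow> real) \<Rightarrow> real \<Rightarrow> ereal \<Rightarrow> real" where
  "batch_customer_pgf z t \<tau> = prob_gen_fun S (\<Sum>j=1..J. p j * customer_pgf z t j \<tau>)"

lemma prob_gen_fun_range: "x \<in> {0..1} \<Longrightarrow> prob_gen_fun S x \<in> {0..1}"
proof -
  assume x: "x \<in> {0..1}"
  have "integrable (measure_pmf S) (\<lambda>n. x ^ n)"
    by (rule measure_pmf.integrable_const_bound[where B = 1]) (use x in \<open>auto intro!: power_le_one\<close>)
  then show ?thesis
    unfolding prob_gen_fun_def using x
    by (auto intro!: measure_pmf.integral_le_const integral_nonneg_AE power_le_one)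
qed

lemma batch_customer_pgf_range:
  assumes z: "\<And>k. k \<in> {1..J} \<Longrightarrow> z k \<in> {0..1}"
  shows "batch_customer_pgf z t \<tau> \<in> {0..1}"
proof -
  have range: "0 \<le> customer_pgf z t j \<tau>" "customer_pgf z t j \<tau> \<le> 1" if "j \<in> {1..J}" for j
    using customer_pgf_range[OF that z, where t = t and \<tau> = \<tau>] by auto
  have "0 \<le> (\<Sum>j=1..J. p j * customer_pgf z t j \<tau>)"
    using range p_nonneg by (intro sum_nonneg mult_nonneg_nonneg) auto
  moreover have "(\<Sum>j=1..J. p j * customer_pgf z t j \<tau>) \<le> (\<Sum>j=1..J. p j)"
    using range p_nonneg by (intro sum_mono mult_left_le) auto
  ultimately show ?thesis
    unfolding batch_customer_pgf_def p_sum by (intro prob_gen_fun_range) simp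
qed

lemma batch_customer_pgf_measurable[measurable]: "batch_customer_pgf z t \<in> borel_measurable borel"
proof -
  have "(\<lambda>x. prob_gen_fun S x) \<in> borel_measurable borel"
    unfolding prob_gen_fun_def by measurable
  moreover have "(\<lambda>\<tau>. \<Sum>j=1..J. p j * customer_pgf z t j \<tau>) \<in> borel_measurable borel"
    using customer_pgf_measurable by measurable
  ultimately show ?thesis
    unfolding batch_customer_pgf_def by (rule measurable_compose[rotated])
qed

text \<open>
  Both sides are limits of the truncated expectations: almost surely only finitely many batches arrive by
  time \<open>t\<close>, and all factors lie in \<open>[0,1]\<close>, so convergence is bounded.
\<close>

lemma expectation_prod_power_queue_count:
  assumes z: "\<And>k. k \<in> {1..J} \<Longrightarrow> z k \<in> {0..1}"
  shows "expectation (\<lambda>\<omega>. \<Prod>k=1..J. z k ^ queue_count J T Sig X t k \<omega>)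
    = expectation (\<lambda>\<omega>. \<Prod>i\<in>{i. T i \<omega> \<le> ereal t}. batch_customer_pgf z t (T i \<omega>))"
proof -
  have weight_lim: "(\<lambda>m. truncated_weight z t m \<omega>) \<longlonglongrightarrow> (\<Prod>k=1..J. z k ^ queue_count J T Sig X t k \<omega>)"
    if fin: "finite {i. T i \<omega> \<le> ereal t}" and \<omega>: "\<omega> \<in> space M" for \<omega>
  proof -
    have "(\<lambda>m. truncated_weight z t m \<omega>) \<longlonglongrightarrow> (\<Prod>i\<in>{i. T i \<omega> \<le> ereal t}. \<Prod>j=1..J. \<Prod>l<Sig i j \<omega>.
        customer_weight z t (T i \<omega>) (X i j l \<omega>))"
      unfolding truncated_weight_def
    proof (rule tendsto_prod_truncated[OF fin])
      show "(\<lambda>m. \<Prod>j=1..J. \<Prod>l<m. if l < Sig i j \<omega> then customer_weight z t (T i \<omega>) (X i j l \<omega>) else 1)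
          \<longlonglongrightarrow> (\<Prod>j=1..J. \<Prod>l<Sig i j \<omega>. customer_weight z t (T i \<omega>) (X i j l \<omega>))" for i
        by (rule tendsto_prod_lessThan_truncated) simp
      show "(\<Prod>j=1..J. \<Prod>l<m. if l < Sig i j \<omega> then customer_weight z t (T i \<omega>) (X i j l \<omega>) else 1) = 1"
        if "i \<notin> {i. T i \<omega> \<le> ereal t}" for m i
        using that by (intro prod.neutral ballI) (simp add: customer_weight_def)
    qed
    also have "(\<Prod>i\<in>{i. T i \<omega> \<le> ereal t}. \<Prod>j=1..J. \<Prod>l<Sig i j \<omega>. customer_weight z t (T i \<omega>) (X i j l \<omega>))
        = (\<Prod>k=1..J. z k ^ queue_count J T Sig X t k \<omega>)"
    proof (subst prod_power_queue_count, rule fin, intro prod.cong refl)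
      fix i j l assume "i \<in> {i. T i \<omega> \<le> ereal t}"
      then show "customer_weight z t (T i \<omega>) (X i j l \<omega>)
          = position_weight J z (X i j l \<omega> (t - real_of_ereal (T i \<omega>)))"
        using T_nonneg[OF \<omega>, of i] by (cases "T i \<omega>") (auto simp: customer_weight_def)
    qed
    finally show ?thesis .
  qed
  have batch_lim: "(\<lambda>m. \<Prod>i<m. expectation (truncated_batch z t m i (T i \<omega>)))
      \<longlonglongrightarrow> (\<Prod>i\<in>{i. T i \<omega> \<le> ereal t}. batch_customer_pgf z t (T i \<omega>))"
    if fin: "finite {i. T i \<omega> \<le> ereal t}" for \<omega>
  proof (rule tendsto_prod_truncated[OF fin])
    show "(\<lambda>m. expectation (truncated_batch z t m i (T i \<omega>))) \<longlonglongrightarrow> batch_customer_pgf z t (T i \<omega>)" for i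
      unfolding truncated_batch_def batch_customer_pgf_def
      by (rule tendsto_expectation_truncated_batch) (use customer_pgf_range[OF _ z] in auto)
    show "expectation (truncated_batch z t m i (T i \<omega>)) = 1" if "i \<notin> {i. T i \<omega> \<le> ereal t}" for m i
    proof -
      have "truncated_batch z t m i (T i \<omega>) = (\<lambda>_. 1)"
        using that by (auto simp: truncated_batch_def customer_pgf_def fun_eq_iff intro!: prod.neutral)
      then show ?thesis by (simp add: prob_space)
    qed
  qed
  note [measurable] = queue_count_measurable
  have "(\<lambda>m. expectation (truncated_weight z t m)) \<longlonglongrightarrow> expectation (\<lambda>\<omega>. \<Prod>k=1..J. z k ^ queue_count J T Sig X t k \<omega>)"
  proof (rule integral_dominated_convergence[where w = "\<lambda>_. 1"])
    show "AE \<omega> in M. (\<lambda>m. truncated_weight z t m \<omega>) \<longlonglongrightarrow> (\<Prod>k=1..J. z k ^ queue_count J T Sig X t k \<omega>)"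
      using AE_finite_points[of t] AE_space by eventually_elim (rule weight_lim)
  qed (use truncated_weight_range[OF z] in auto)
  moreover have "(\<lambda>m. expectation (\<lambda>\<omega>. \<Prod>i<m. expectation (truncated_batch z t m i (T i \<omega>)))) \<longlonglongrightarrow>
      expectation (\<lambda>\<omega>. \<Prod>i\<in>{i. T i \<omega> \<le> ereal t}. batch_customer_pgf z t (T i \<omega>))"
  proof (rule integral_dominated_convergence[where w = "\<lambda>_. 1"])
    show "AE \<omega> in M. (\<lambda>m. \<Prod>i<m. expectation (truncated_batch z t m i (T i \<omega>))) \<longlonglongrightarrow>
        (\<Prod>i\<in>{i. T i \<omega> \<le> ereal t}. batch_customer_pgf z t (T i \<omega>))"
      using AE_finite_points[of t] by eventually_elim (rule batch_lim)
    show "(\<lambda>\<omega>. \<Prod>i\<in>{i. T i \<omega> \<le> ereal t}. batch_customer_pgf z t (T i \<omega>)) \<in> borel_measurable M"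
      by (rule borel_measurable_prod_random_set) auto
    show "AE \<omega> in M. norm (\<Prod>i<m. expectation (truncated_batch z t m i (T i \<omega>))) \<le> 1" for m
      using expectation_truncated_batch_range[OF z]
      by (intro AE_I2) (auto simp: abs_prod intro!: prod_le_1)
  qed auto
  ultimately show ?thesis
    by (simp only: expectation_truncated_weight[OF z]) (rule LIMSEQ_unique)
qed

text \<open>
  The entry queue is averaged out by the batch generating function, which sees the customer factors
  only through \<open>\<Sum>j. p j * customer_pgf z t j \<tau>\<close>; hence only the averaged probabilities \<open>queue_prob\<close> remain.
\<close>

theorem queue_count_pgf:
  assumes z: "\<And>k. k \<in> {1..J} \<Longrightarrow> z k \<in> {0..1}"
  shows "expectation (\<lambda>\<omega>. \<Prod>k=1..J. z k ^ queue_count J T Sig X t k \<omega>)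
    = exp (LBINT \<tau>:{0..t}. lam \<tau> *
        (prob_gen_fun S (1 - (\<Sum>k=1..J. (1 - z k) * queue_prob J p qe k (t - \<tau>))) - 1))"
proof -
  have integrand: "lam \<tau> * (batch_customer_pgf z t (ereal \<tau>) - 1) = lam \<tau> *
        (prob_gen_fun S (1 - (\<Sum>k=1..J. (1 - z k) * queue_prob J p qe k (t - \<tau>))) - 1)" if \<tau>: "\<tau> \<in> {0..t}" for \<tau>
  proof -
    have "(\<Sum>j=1..J. p j * customer_pgf z t j (ereal \<tau>))
        = (\<Sum>j=1..J. p j) - (\<Sum>j=1..J. \<Sum>k=1..J. p j * ((1 - z k) * qe j k (t - \<tau>)))"
      using \<tau> by (simp add: customer_pgf_def algebra_simps sum_subtractf sum.distrib sum_distrib_left)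
    also have "(\<Sum>j=1..J. \<Sum>k=1..J. p j * ((1 - z k) * qe j k (t - \<tau>)))
        = (\<Sum>k=1..J. (1 - z k) * queue_prob J p qe k (t - \<tau>))"
      unfolding queue_prob_def sum_distrib_left by (subst sum.swap) (simp add: ac_simps)
    finally show "lam \<tau> * (batch_customer_pgf z t (ereal \<tau>) - 1) = lam \<tau> *
      (prob_gen_fun S (1 - (\<Sum>k=1..J. (1 - z k) * queue_prob J p qe k (t - \<tau>))) - 1)"
      by (simp only: batch_customer_pgf_def p_sum)
  qed
  have "expectation (\<lambda>\<omega>. \<Prod>k=1..J. z k ^ queue_count J T Sig X t k \<omega>)
    = expectation (\<lambda>\<omega>. \<Prod>i\<in>{i. T i \<omega> \<le> ereal t}. batch_customer_pgf z t (ereal (real_of_ereal (T i \<omega>))))"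
  proof -
    have "(\<Prod>i\<in>{i. T i \<omega> \<le> ereal t}. batch_customer_pgf z t (T i \<omega>))
        = (\<Prod>i\<in>{i. T i \<omega> \<le> ereal t}. batch_customer_pgf z t (ereal (real_of_ereal (T i \<omega>))))"
      if "\<omega> \<in> space M" for \<omega>
    proof (rule prod.cong[OF refl])
      fix i assume "i \<in> {i. T i \<omega> \<le> ereal t}"
      then show "batch_customer_pgf z t (T i \<omega>) = batch_customer_pgf z t (ereal (real_of_ereal (T i \<omega>)))"
        using T_nonneg[OF that, of i] by (cases "T i \<omega>") auto
    qed
    then have "expectation (\<lambda>\<omega>. \<Prod>i\<in>{i. T i \<omega> \<le> ereal t}. batch_customer_pgf z t (T i \<omega>))
        = expectation (\<lambda>\<omega>. \<Prod>i\<in>{i. T i \<omega> \<le> ereal t}. batch_customer_pgf z t (ereal (real_of_ereal (T i \<omega>))))"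
      by (rule Bochner_Integration.integral_cong[OF refl])
    moreover have "expectation (\<lambda>\<omega>. \<Prod>k=1..J. z k ^ queue_count J T Sig X t k \<omega>)
        = expectation (\<lambda>\<omega>. \<Prod>i\<in>{i. T i \<omega> \<le> ereal t}. batch_customer_pgf z t (T i \<omega>))"
      by (rule expectation_prod_power_queue_count) (rule z)
    ultimately show ?thesis by simp
  qed
  also have "\<dots> = exp (LBINT \<tau>:{0..t}. lam \<tau> * (batch_customer_pgf z t (ereal \<tau>) - 1))"
    by (rule poisson_process_expectation_prod[OF arrivals lam_nonneg lam_integrable])
       (use batch_customer_pgf_range[OF z] in auto)
  also have "(LBINT \<tau>:{0..t}. lam \<tau> * (batch_customer_pgf z t (ereal \<tau>) - 1)) = (LBINT \<tau>:{0..t}. lam \<tau> *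
        (prob_gen_fun S (1 - (\<Sum>k=1..J. (1 - z k) * queue_prob J p qe k (t - \<tau>))) - 1))"
    by (rule set_lebesgue_integral_cong) (simp, blast intro: integrand)
  finally show ?thesis .
qed

end

section \<open>The recursion for Poisson batches\<close>

lemma prod_of_bool: "finite A \<Longrightarrow> (\<Prod>x\<in>A. of_bool (Q x) :: real) = of_bool (\<forall>x\<in>A. Q x)"
  by (induction A rule: finite_induct) auto

context batch_network
begin

text \<open>
  Poisson thinning: \<open>G_S (1 - x) = exp (- mu * x)\<close>, so the customers of a batch found in the
  different queues at time \<open>t\<close> behave as independent Poisson counts of means \<open>mu * q k\<close>.
\<close>

lemma compound_poisson_counts_queue_count:
  assumes S: "S = poisson_law mu" and mu: "0 \<le> mu"
  shows "compound_poisson_counts M (queue_count J T Sig X t) {1..J} lborel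
    (\<lambda>\<tau>. indicator {0..t} \<tau> * lam \<tau> * exp (- mu * (\<Sum>k=1..J. queue_prob J p qe k (max 0 (t - \<tau>)))))
    (\<lambda>k \<tau>. queue_prob J p qe k (max 0 (t - \<tau>)) * mu) (LBINT \<tau>:{0..t}. lam \<tau>)"
proof -
  define r where "r = (\<lambda>k \<tau>. queue_prob J p qe k (max 0 (t - \<tau>)) * mu)"
  define l where "l = (\<lambda>\<tau>. indicator {0..t} \<tau> * lam \<tau>)"
  define W where "W = (\<lambda>\<tau>. l \<tau> * exp (- mu * (\<Sum>k=1..J. queue_prob J p qe k (max 0 (t - \<tau>)))))"
  have W_eq: "W \<tau> = l \<tau> * exp (- (\<Sum>k=1..J. r k \<tau>))" for \<tau>
    unfolding W_def r_def by (simp add: sum_distrib_left sum_negf mult.commute)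
  have l: "integrable lborel l"
    using lam_integrable[of t] by (simp add: set_integrable_def l_def)
  have l_nonneg: "0 \<le> l \<tau>" for \<tau>
    using lam_nonneg[of \<tau>] by (auto simp: l_def indicator_def)
  have r_measurable: "r k \<in> borel_measurable lborel" if k: "k \<in> {1..J}" for k
  proof -
    have "(\<lambda>\<tau>. qe j k (max 0 (t - \<tau>))) \<in> borel_measurable borel" if "j \<in> {1..J}" for j
      by (rule measurable_compose[OF _ qe_measurable[OF that k]]) simp
    then show ?thesis
      unfolding r_def queue_prob_def by simp
  qed
  have r_nonneg: "0 \<le> r k \<tau>" if "k \<in> {1..J}" for k \<tau>
    unfolding r_def queue_prob_def using that mu p_nonneg qe_nonneg
    by (intro mult_nonneg_nonneg sum_nonneg) auto
  have exp_measurable: "(\<lambda>x. exp (f x)) \<in> borel_measurable lborel"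
    if "f \<in> borel_measurable lborel" for f :: "real \<Rightarrow> real"
    using that by (rule measurable_compose) simp
  have "compound_poisson_counts M (queue_count J T Sig X t) {1..J} lborel W r (LBINT \<tau>:{0..t}. lam \<tau>)"
  proof unfold_locales
    show "finite {1..J}" by simp
    show "queue_count J T Sig X t k \<in> measurable M (count_space UNIV)" for k
      by (rule queue_count_measurable)
    show "r k \<in> borel_measurable lborel" if "k \<in> {1..J}" for k
      by (rule r_measurable[OF that])
    show "0 \<le> r k \<tau>" if "k \<in> {1..J}" for k \<tau>
      by (rule r_nonneg[OF that])
    show "0 \<le> W \<tau>" for \<tau>
      unfolding W_def using l_nonneg by simp
    show "W \<in> borel_measurable lborel"
      unfolding W_eq
      by (intro borel_measurable_times exp_measurable borel_measurable_uminus borel_measurable_sum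
          borel_measurable_integrable[OF l] r_measurable)
    have "W \<tau> * (\<Prod>k=1..J. exp (r k \<tau>)) = l \<tau>" for \<tau>
    proof -
      have "(\<Prod>k=1..J. exp (r k \<tau>)) = exp (\<Sum>k=1..J. r k \<tau>)"
        by (rule exp_sum[symmetric]) simp
      then show ?thesis unfolding W_eq by (simp only: mult.assoc mult_exp_exp) simp
    qed
    then show "integrable lborel (\<lambda>\<tau>. W \<tau> * (\<Prod>k=1..J. exp (r k \<tau>)))"
      using l by simp
    fix z :: "nat \<Rightarrow> real" assume z: "\<And>k. k \<in> {1..J} \<Longrightarrow> z k \<in> {0..1}"
    have W_prod: "W \<tau> * (\<Prod>k=1..J. exp (r k \<tau> * z k)) = l \<tau> * exp (- (\<Sum>k=1..J. (1 - z k) * r k \<tau>))" for \<tau>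
    proof -
      have "(\<Prod>k=1..J. exp (r k \<tau> * z k)) = exp (\<Sum>k=1..J. r k \<tau> * z k)"
        by (rule exp_sum[symmetric]) simp
      moreover have "- (\<Sum>k=1..J. r k \<tau>) + (\<Sum>k=1..J. r k \<tau> * z k) = - (\<Sum>k=1..J. (1 - z k) * r k \<tau>)"
        by (simp add: algebra_simps sum_subtractf)
      ultimately show ?thesis unfolding W_eq by (simp only: mult.assoc mult_exp_exp)
    qed
    have "integrable lborel (\<lambda>\<tau>. W \<tau> * (\<Prod>k=1..J. exp (r k \<tau> * z k)))"
      unfolding W_prod
    proof (rule Bochner_Integration.integrable_bound[OF l])
      show "(\<lambda>\<tau>. l \<tau> * exp (- (\<Sum>k=1..J. (1 - z k) * r k \<tau>))) \<in> borel_measurable lborel"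
        by (intro borel_measurable_times exp_measurable borel_measurable_uminus borel_measurable_sum
            borel_measurable_integrable[OF l] borel_measurable_const r_measurable)
      show "AE \<tau> in lborel. norm (l \<tau> * exp (- (\<Sum>k=1..J. (1 - z k) * r k \<tau>))) \<le> norm (l \<tau>)"
        using l_nonneg z r_nonneg
        by (intro AE_I2) (auto simp: abs_mult intro!: mult_left_le sum_nonneg mult_nonneg_nonneg)
    qed
    then have "(\<integral>\<tau>. W \<tau> * (\<Prod>k=1..J. exp (r k \<tau> * z k)) \<partial>lborel) - (LBINT \<tau>:{0..t}. lam \<tau>)
        = (\<integral>\<tau>. W \<tau> * (\<Prod>k=1..J. exp (r k \<tau> * z k)) - l \<tau> \<partial>lborel)"
      using l by (simp add: set_lebesgue_integral_def l_def)
    also have "\<dots> = (LBINT \<tau>:{0..t}. lam \<tau> *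
        (prob_gen_fun S (1 - (\<Sum>k=1..J. (1 - z k) * queue_prob J p qe k (t - \<tau>))) - 1))"
      unfolding set_lebesgue_integral_def
    proof (rule Bochner_Integration.integral_cong[OF refl])
      fix \<tau>
      have "prob_gen_fun S x = exp (mu * (x - 1))" for x
        unfolding prob_gen_fun_def S by (rule expectation_power_poisson_law(1)[OF mu])
      then have pgf: "prob_gen_fun S (1 - x) = exp (- (mu * x))" for x
        by simp
      show "W \<tau> * (\<Prod>k=1..J. exp (r k \<tau> * z k)) - l \<tau> = indicator {0..t} \<tau> *\<^sub>R (lam \<tau> *
          (prob_gen_fun S (1 - (\<Sum>k=1..J. (1 - z k) * queue_prob J p qe k (t - \<tau>))) - 1))"
      proof (cases "\<tau> \<in> {0..t}")
        case True
        have "(\<Sum>k=1..J. (1 - z k) * r k \<tau>) = mu * (\<Sum>k=1..J. (1 - z k) * queue_prob J p qe k (t - \<tau>))"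
          using True unfolding r_def sum_distrib_left by (intro sum.cong) (auto simp: ac_simps)
        then show ?thesis
          using True unfolding W_prod pgf by (simp add: l_def algebra_simps)
      next
        case False
        then show ?thesis unfolding W_prod by (simp add: l_def)
      qed
    qed
    finally show "expectation (\<lambda>\<omega>. \<Prod>k=1..J. z k ^ queue_count J T Sig X t k \<omega>)
        = exp ((\<integral>\<tau>. W \<tau> * (\<Prod>k=1..J. exp (r k \<tau> * z k)) \<partial>lborel) - (LBINT \<tau>:{0..t}. lam \<tau>))"
      by (subst queue_count_pgf) (simp_all only: z)
  qed
  then show ?thesis
    unfolding W_def r_def l_def .
qed

text \<open>
  The recursion is read off at \<open>z = 0\<close> with \<open>K = {1..v}\<close>: the factor \<open>0 ^ N\<^sub>k\<close> is the indicator of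
  \<open>N\<^sub>k = 0\<close>, and \<open>exp (r k \<tau> * 0) = 1\<close> removes the queues above \<open>v\<close> from the rate. Indices with \<open>i v = 0\<close> do
  not contribute.
\<close>

lemma queue_count_recursion:
  fixes t :: real and n :: "nat \<Rightarrow> nat"
  assumes S: "S = poisson_law mu" and mu: "0 \<le> mu" and v: "v \<in> {1..J}" "1 \<le> n v"
  defines "q \<equiv> queue_prob J p qe"
    and "P \<equiv> (\<lambda>m. prob {\<omega> \<in> space M. \<forall>k\<in>{1..J}.
               queue_count J T Sig X t k \<omega> = (if k \<le> v then m k else 0)})"
  shows "P n = (\<Sum>i\<in>(\<Pi>\<^sub>E k\<in>{1..v}. if k = v then {1..n v} else {0..n k}).
      real (i v) / real (n v) * P (\<lambda>k. n k - i k) *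
      (LBINT \<tau>:{0..t}. lam \<tau> * (\<Prod>k=1..v. (q k (t - \<tau>) * mu) ^ i k / fact (i k)) *
         exp (- mu * (\<Sum>k=1..J. q k (t - \<tau>)))))"
proof -
  interpret C: compound_poisson_counts M "queue_count J T Sig X t" "{1..J}" lborel
    "\<lambda>\<tau>. indicator {0..t} \<tau> * lam \<tau> * exp (- mu * (\<Sum>k=1..J. queue_prob J p qe k (max 0 (t - \<tau>))))"
    "\<lambda>k \<tau>. queue_prob J p qe k (max 0 (t - \<tau>)) * mu" "LBINT \<tau>:{0..t}. lam \<tau>"
    by (rule compound_poisson_counts_queue_count[OF S mu])
  have P_eq: "C.mixed_pgf {1..v} m (\<lambda>_. 0) = P m" for m
  proof -
    have "C.mixed_pgf {1..v} m (\<lambda>_. 0) = expectation (\<lambda>\<omega>. \<Prod>k=1..J.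
        of_bool (queue_count J T Sig X t k \<omega> = (if k \<le> v then m k else 0)))"
      unfolding C.mixed_pgf_def
    proof (intro Bochner_Integration.integral_cong prod.cong refl)
      show "(if k \<in> {1..v} then of_bool (queue_count J T Sig X t k \<omega> = m k) else (0::real) ^ queue_count J T Sig X t k \<omega>)
          = of_bool (queue_count J T Sig X t k \<omega> = (if k \<le> v then m k else 0))" if "k \<in> {1..J}" for k \<omega>
        using that by (simp add: power_0_left)
    qed
    also have "\<dots> = expectation (indicator {\<omega> \<in> space M. \<forall>k\<in>{1..J}.
        queue_count J T Sig X t k \<omega> = (if k \<le> v then m k else 0)})"
      by (intro Bochner_Integration.integral_cong refl, subst prod_of_bool)
         (simp_all only: finite_atLeastAtMost indicator_def of_bool_def mem_Collect_eq simp_thms)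
    also have "\<dots> = P m"
    proof -
      have "{\<omega> \<in> space M. Q \<omega>} \<inter> space M = {\<omega> \<in> space M. Q \<omega>}" for Q by auto
      then show ?thesis unfolding P_def Bochner_Integration.integral_indicator by (simp only:)
    qed
    finally show ?thesis .
  qed
  define A where "A = (\<lambda>i. C.mixed_rate {1..v} i (\<lambda>_. 0))"
  have A_eq: "A i =
      (LBINT \<tau>:{0..t}. lam \<tau> * (\<Prod>k=1..v. (q k (t - \<tau>) * mu) ^ i k / fact (i k)) *
         exp (- mu * (\<Sum>k=1..J. q k (t - \<tau>))))" for i
    unfolding A_def C.mixed_rate_def set_lebesgue_integral_def
  proof (rule Bochner_Integration.integral_cong[OF refl])
    fix \<tau>
    have prods: "(\<Prod>k=1..J. if k \<in> {1..v} then (q k (t - \<tau>) * mu) ^ i k / fact (i k) else exp (q k (t - \<tau>) * mu * 0))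
        = (\<Prod>k=1..v. (q k (t - \<tau>) * mu) ^ i k / fact (i k))"
      using v(1) by (intro prod.mono_neutral_cong_right) auto
    show "indicat_real {0..t} \<tau> * lam \<tau> * exp (- mu * (\<Sum>k=1..J. queue_prob J p qe k (max 0 (t - \<tau>)))) *
        (\<Prod>k=1..J. if k \<in> {1..v} then (queue_prob J p qe k (max 0 (t - \<tau>)) * mu) ^ i k / fact (i k)
          else exp (queue_prob J p qe k (max 0 (t - \<tau>)) * mu * 0))
      = indicat_real {0..t} \<tau> *\<^sub>R (lam \<tau> * (\<Prod>k=1..v. (q k (t - \<tau>) * mu) ^ i k / fact (i k)) *
         exp (- mu * (\<Sum>k=1..J. q k (t - \<tau>))))"
    proof (cases "\<tau> \<in> {0..t}")
      case True
      then have "max 0 (t - \<tau>) = t - \<tau>" by simp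
      with prods show ?thesis
        unfolding q_def using True by (simp only: indicator_simps mult_1 real_scaleR_def mult_ac)
    qed simp
  qed
  have "real (n v) * P n = (\<Sum>i\<in>(\<Pi>\<^sub>E k\<in>{1..v}. {..n k}). real (i v) * A i * P (\<lambda>k. n k - i k))"
    unfolding P_eq[symmetric] A_def
  proof (rule C.mixed_recursion)
    show "{1..v} \<subseteq> {1..J}" "v \<in> {1..v}" using v(1) by auto
  qed simp
  also have "\<dots> = (\<Sum>i\<in>(\<Pi>\<^sub>E k\<in>{1..v}. if k = v then {1..n v} else {0..n k}). real (i v) * A i * P (\<lambda>k. n k - i k))"
  proof (rule sum.mono_neutral_right)
    show "(\<Pi>\<^sub>E k\<in>{1..v}. if k = v then {1..n v} else {0..n k}) \<subseteq> (\<Pi>\<^sub>E k\<in>{1..v}. {..n k})"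
      by (rule PiE_mono) auto
    show "\<forall>i\<in>(\<Pi>\<^sub>E k\<in>{1..v}. {..n k}) - (\<Pi>\<^sub>E k\<in>{1..v}. if k = v then {1..n v} else {0..n k}).
        real (i v) * A i * P (\<lambda>k. n k - i k) = 0"
    proof
      fix i assume i: "i \<in> (\<Pi>\<^sub>E k\<in>{1..v}. {..n k}) - (\<Pi>\<^sub>E k\<in>{1..v}. if k = v then {1..n v} else {0..n k})"
      have "i v = 0"
      proof (rule ccontr)
        assume "i v \<noteq> 0"
        with i have "i \<in> (\<Pi>\<^sub>E k\<in>{1..v}. if k = v then {1..n v} else {0..n k})"
          by (auto simp: PiE_iff)
        with i show False by auto
      qed
      then show "real (i v) * A i * P (\<lambda>k. n k - i k) = 0" by simp
    qed
  qed (simp add: finite_PiE)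
  finally have "P n = (\<Sum>i\<in>(\<Pi>\<^sub>E k\<in>{1..v}. if k = v then {1..n v} else {0..n k}).
      real (i v) * A i * P (\<lambda>k. n k - i k)) / real (n v)"
    using v(2) by (simp add: nonzero_eq_divide_eq mult.commute)
  then show ?thesis
    unfolding sum_divide_distrib A_eq[symmetric]
    by (elim trans, intro sum.cong refl) simp
qed

end

(* The factor exp (- mu) of the printed formula is correct only if no customer leaves the
   network within time t, i.e. if the q k s sum to 1. When customers may leave, the batch
   contributes G_S^(n) evaluated at 1 - (sum of the q k), which gives
   exp (- mu * sum of the q k) instead. Both forms are stated. *)
theorem corollary5p1p2:
  fixes M :: "'a measure" and J v :: nat and lam :: "real \<Rightarrow> real"
    and T :: "nat \<Rightarrow> 'a \<Rightarrow> ereal" and BS :: "(nat \<Rightarrow> nat) measure" and S :: "nat pmf"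
    and p :: "nat \<Rightarrow> real" and Sig :: "nat \<Rightarrow> nat \<Rightarrow> 'a \<Rightarrow> nat"
    and D :: "(real \<Rightarrow> nat) measure" and X :: "nat \<Rightarrow> nat \<Rightarrow> nat \<Rightarrow> 'a \<Rightarrow> real \<Rightarrow> nat"
    and qe :: "nat \<Rightarrow> nat \<Rightarrow> real \<Rightarrow> real" and mu t :: real and n :: "nat \<Rightarrow> nat"
  defines "q \<equiv> queue_prob J p qe"
    and "P \<equiv> (\<lambda>m. measure M {\<omega> \<in> space M. \<forall>k\<in>{1..J}.
               queue_count J T Sig X t k \<omega> = (if k \<le> v then m k else 0)})"
    and "I \<equiv> (\<Pi>\<^sub>E k\<in>{1..v}. if k = v then {1..n v} else {0..n k})"
  assumes "batch_network M J lam T BS S p Sig D X qe"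
    and "mu \<ge> 0" and "S = poisson_law mu"
    and "t \<ge> 0" and "v \<in> {2..J}" and "n v \<ge> 1"
  shows "P n = (\<Sum>i\<in>I. real (i v) / real (n v) * P (\<lambda>k. n k - i k) *
            (LBINT \<tau>:{0..t}. lam \<tau> * (\<Prod>k=1..v. (q k (t - \<tau>) * mu) ^ i k / fact (i k)) *
               exp (- mu * (\<Sum>k=1..J. q k (t - \<tau>)))))
         \<and> ((\<forall>s\<in>{0..t}. (\<Sum>k=1..J. q k s) = 1) \<longrightarrow>
            P n = (\<Sum>i\<in>I. real (i v) / real (n v) * P (\<lambda>k. n k - i k) *
            (LBINT \<tau>:{0..t}. lam \<tau> * (\<Prod>k=1..v. (q k (t - \<tau>) * mu) ^ i k / fact (i k)) *
               exp (- mu))))"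
proof -
  interpret batch_network M J lam T BS S p Sig D X qe by fact
  have rec: "P n = (\<Sum>i\<in>I. real (i v) / real (n v) * P (\<lambda>k. n k - i k) *
            (LBINT \<tau>:{0..t}. lam \<tau> * (\<Prod>k=1..v. (q k (t - \<tau>) * mu) ^ i k / fact (i k)) *
               exp (- mu * (\<Sum>k=1..J. q k (t - \<tau>)))))"
    unfolding P_def I_def q_def
  proof (rule queue_count_recursion)
    show "S = poisson_law mu" "0 \<le> mu" "1 \<le> n v" "v \<in> {1..J}"
      using assms(5-) by simp_all
  qed
  moreover have "P n = (\<Sum>i\<in>I. real (i v) / real (n v) * P (\<lambda>k. n k - i k) *
            (LBINT \<tau>:{0..t}. lam \<tau> * (\<Prod>k=1..v. (q k (t - \<tau>) * mu) ^ i k / fact (i k)) *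
               exp (- mu)))"
    if stay: "\<forall>s\<in>{0..t}. (\<Sum>k=1..J. q k s) = 1"
  proof -
    have "(LBINT \<tau>:{0..t}. lam \<tau> * (\<Prod>k=1..v. (q k (t - \<tau>) * mu) ^ i k / fact (i k)) *
               exp (- mu * (\<Sum>k=1..J. q k (t - \<tau>))))
        = (LBINT \<tau>:{0..t}. lam \<tau> * (\<Prod>k=1..v. (q k (t - \<tau>) * mu) ^ i k / fact (i k)) * exp (- mu))" for i
    proof (rule set_lebesgue_integral_cong, simp, intro allI impI)
      fix \<tau> assume "\<tau> \<in> {0..t}"
      then have "(\<Sum>k=1..J. q k (t - \<tau>)) = 1" using stay by simp
      then show "lam \<tau> * (\<Prod>k=1..v. (q k (t - \<tau>) * mu) ^ i k / fact (i k)) * exp (- mu * (\<Sum>k=1..J. q k (t - \<tau>)))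
        = lam \<tau> * (\<Prod>k=1..v. (q k (t - \<tau>) * mu) ^ i k / fact (i k)) * exp (- mu)"
        by simp
    qed
    then show ?thesis using rec by simp
  qed
  ultimately show ?thesis by blast
qed

end
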